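(* Let $G$ be an analytic graph on a Hausdorff space. Then exactly one of the following holds: (1) $\chi_B(G)\le 2$. (2) There is a continuous homomorphism from $\mathbb L_0$ to $G$.
   Context: A graph on $X$ is an irreflexive symmetric $G\subseteq X^2$; it is analytic if it is a continuous image of $\mathbb N^{\mathbb N}$. $\chi_B(G)$ is the least cardinal $\kappa$ carrying a standard Borel structure such that there is a Borel map $c\colon X\to\kappa$ with $c(x)\neq c(y)$ whenever $(x,y)\in G$. A homomorphism from $H$ on $Y$ to $G$ on $X$ is a map $\phi$ with $(x,y)\in H\Rightarrow(\phi(x),\phi(y))\in G$. Definition of $\mathbb L_0$: let $c\in\mathbb N^{\mathbb N}$ be given by $c(0)=1$ and $c(n)=2n-1$ for $n>0$. For $n\in\mathbb N$ let $X_{c,n}=\bigcup_{m\le n}\{0,\dots,c(m)\}\times 2^{n-m}$, whose elements are written as finite sequences $(k)^\frown t$ with $k\le c(m)$, $t\in2^{n-m}$. For $N\in\mathbb N$ let $L_N$ be the path on $\{(0),\dots,(N)\}$ in which $(i),(j)$ are adjacent iff $|i-j|=1$. Let $s_0=(c(0))$ and for $n>0$ let $s_n=(0,\dots,0,1)$ ($n$ zeros then $1$). Let $L_{c,0}=L_{c(0)}$ and let $L_{c,n+1}$ be the graph on $X_{c,n+1}$ whose edges are: $\{v_0{}^\frown(j),v_1{}^\frown(j)\}$ for $j<2$ and $\{v_0,v_1\}$ an edge of $L_{c,n}$; the edges of $L_{c(n+1)}$; and the edges $\{s_n{}^\frown(0),(0)\}$ and $\{(c(n+1)),s_n{}^\frown(1)\}$.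 Let $X_c=\{(n,k,r)\in\mathbb N\times\mathbb N\times2^{\mathbb N}:k\le c(n)\}$ with the subspace topology of $\mathbb N\times\mathbb N\times 2^{\mathbb N}$ (a Polish space), and for $m\le n$ let $\pi_{c,n}(m,k,r)=(k)^\frown(r|(n-m))$. Then $\mathbb L_0$ is the graph on $X_c$ consisting of all pairs $((n_0,k_0,r_0),(n_1,k_1,r_1))$ such that $\{\pi_{c,n}(n_0,k_0,r_0),\pi_{c,n}(n_1,k_1,r_1)\}$ is an edge of $L_{c,n}$ for all $n\ge\max(n_0,n_1)$. *)

theory Defs
  imports "HOL-Analysis.Analysis"
begin

section \<open>Graphs, homomorphisms, analyticity\<close>

definition graph_on :: "'a set \<Rightarrow> ('a \<times> 'a) set \<Rightarrow> bool" where
  "graph_on X G \<longleftrightarrow> G \<subseteq> X \<times> X \<and> irrefl G \<and> sym G"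

definition graph_hom ::
    "'b set \<Rightarrow> ('b \<times> 'b) set \<Rightarrow> 'a set \<Rightarrow> ('a \<times> 'a) set \<Rightarrow> ('b \<Rightarrow> 'a) \<Rightarrow> bool" where
  "graph_hom Y H X G \<phi> \<longleftrightarrow>
     \<phi> ` Y \<subseteq> X \<and> (\<forall>x y. (x, y) \<in> H \<longrightarrow> (\<phi> x, \<phi> y) \<in> G)"

text \<open>A continuous image of Baire space, with \<^typ>\<open>nat \<Rightarrow> nat\<close> carrying the product of the
  discrete topologies. Read literally, this excludes the empty set.\<close>

definition analytic_set :: "'a::topological_space set \<Rightarrow> bool" where
  "analytic_set A \<longleftrightarrow>
     (\<exists>f :: (nat \<Rightarrow> nat) \<Rightarrow> 'a. continuous_on UNIV f \<and> range f = A)"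


section \<open>Borel chromatic numbers\<close>

definition standard_borel :: "'b measure \<Rightarrow> bool" where
  "standard_borel M \<longleftrightarrow>
     (\<exists>T. topspace T = space M \<and> completely_metrizable_space T \<and> second_countable T \<and>
          sets M = sigma_sets (space M) {U. openin T U})"

text \<open>Only the \<open>\<sigma>\<close>-algebra of \<open>M\<close> matters; its measure plays no role. Cardinals are represented by
  cardinal orders \<open>\<kappa>\<close>, whose underlying set is \<open>Field \<kappa>\<close>.\<close>

definition borel_colourable :: "('a::topological_space \<times> 'a) set \<Rightarrow> 'k rel \<Rightarrow> bool" where
  "borel_colourable G \<kappa> \<longleftrightarrow>
     (\<exists>M f. space M = Field \<kappa> \<and> standard_borel M \<and> f \<in> measurable borel M \<and>
            (\<forall>x y. (x, y) \<in> G \<longrightarrow> f x \<noteq> f y))"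

text \<open>A standard Borel space has at most the cardinality of the continuum, so cardinal orders on
  subsets of \<^typ>\<open>real\<close> represent every cardinal that can occur. The number is unique up to
  order isomorphism, and need not exist; hence a predicate.\<close>

definition is_borel_chromatic_number ::
    "('a::topological_space \<times> 'a) set \<Rightarrow> real rel \<Rightarrow> bool" where
  "is_borel_chromatic_number G \<kappa> \<longleftrightarrow>
     Card_order \<kappa> \<and> borel_colourable G \<kappa> \<and>
     (\<forall>\<mu> :: real rel. Card_order \<mu> \<and> borel_colourable G \<mu> \<longrightarrow> (\<kappa>, \<mu>) \<in> ordLeq)"

definition borel_chromatic_number_le ::
    "('a::topological_space \<times> 'a) set \<Rightarrow> nat \<Rightarrow> bool" where
  "borel_chromatic_number_le G n \<longleftrightarrow>
     (\<exists>\<kappa>. is_borel_chromatic_number G \<kappa> \<and> (\<kappa>, card_of {..<n}) \<in> ordLeq)"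


section \<open>The graph \<open>L\<^sub>0\<close>\<close>

text \<open>Finite sequences are lists of naturals, \<open>2 = {0, 1}\<close>, and the edges of the finite graphs are
  unordered pairs.\<close>

definition X_fin :: "(nat \<Rightarrow> nat) \<Rightarrow> nat \<Rightarrow> nat list set" where
  "X_fin c n = (\<Union>m\<le>n. {k # t | k t. k \<le> c m \<and> length t = n - m \<and> set t \<subseteq> {0, 1}})"

definition path_edges :: "nat \<Rightarrow> nat list set set" where
  "path_edges N = {{[i], [j]} | i j. i \<le> N \<and> j \<le> N \<and> \<bar>int i - int j\<bar> = 1}"

definition s_seq :: "(nat \<Rightarrow> nat) \<Rightarrow> nat \<Rightarrow> nat list" where
  "s_seq c n = (if n = 0 then [c 0] else replicate n 0 @ [1])"

primrec L_fin :: "(nat \<Rightarrow> nat) \<Rightarrow> nat \<Rightarrow> nat list set set" where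
  "L_fin c 0 = path_edges (c 0)"
| "L_fin c (Suc n) =
     {{v0 @ [j], v1 @ [j]} | v0 v1 j. j < 2 \<and> {v0, v1} \<in> L_fin c n}
     \<union> path_edges (c (Suc n))
     \<union> {{s_seq c n @ [0], [0]}, {[c (Suc n)], s_seq c n @ [1]}}"

text \<open>Cantor space is the subspace of \<open>0\<close>-\<open>1\<close>-valued functions in \<^typ>\<open>nat \<Rightarrow> nat\<close>.\<close>

definition X_lim :: "(nat \<Rightarrow> nat) \<Rightarrow> (nat \<times> nat \<times> (nat \<Rightarrow> nat)) set" where
  "X_lim c = {(n, k, r). k \<le> c n \<and> range r \<subseteq> {0, 1}}"

text \<open>Only meaningful for \<open>m \<le> n\<close>.\<close>

definition pi_fin :: "nat \<Rightarrow> nat \<times> nat \<times> (nat \<Rightarrow> nat) \<Rightarrow> nat list" where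
  "pi_fin n = (\<lambda>(m, k, r). k # map r [0..<n - m])"

definition L_lim :: "(nat \<Rightarrow> nat) \<Rightarrow>
    ((nat \<times> nat \<times> (nat \<Rightarrow> nat)) \<times> (nat \<times> nat \<times> (nat \<Rightarrow> nat))) set" where
  "L_lim c = {(x, y). x \<in> X_lim c \<and> y \<in> X_lim c \<and>
     (\<forall>n \<ge> max (fst x) (fst y). {pi_fin n x, pi_fin n y} \<in> L_fin c n)}"

definition c\<^sub>0 :: "nat \<Rightarrow> nat" where
  "c\<^sub>0 n = (if n = 0 then 1 else 2 * n - 1)"

definition X\<^sub>0 :: "(nat \<times> nat \<times> (nat \<Rightarrow> nat)) set" where
  "X\<^sub>0 = X_lim c\<^sub>0"

definition L\<^sub>0 :: "((nat \<times> nat \<times> (nat \<Rightarrow> nat)) \<times> (nat \<times> nat \<times> (nat \<Rightarrow> nat))) set" where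
  "L\<^sub>0 = L_lim c\<^sub>0"

lemma s_seq_in_X_fin:
  assumes "0 < c 0"
  shows "s_seq c n \<in> X_fin c n"
proof (cases n)
  case 0
  then show ?thesis by (auto simp: s_seq_def X_fin_def)
next
  case (Suc k)
  have "s_seq c n = 0 # (replicate k 0 @ [1])" by (simp add: Suc s_seq_def)
  then show ?thesis unfolding X_fin_def using Suc by (auto intro!: bexI[of _ 0])
qed

lemma path_edges_in_X_fin:
  "e \<in> path_edges (c n) \<Longrightarrow> e \<subseteq> X_fin c n \<and> card e = 2"
  by (auto simp: path_edges_def X_fin_def card_insert_if)

lemma append_in_X_fin:
  assumes "v \<in> X_fin c n" "j < 2"
  shows "v @ [j] \<in> X_fin c (Suc n)"
proof -
  obtain m k t where "m \<le> n" "v = k # t" "k \<le> c m" "length t = n - m" "set t \<subseteq> {0, 1}"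
    using assms(1) by (auto simp: X_fin_def)
  then show ?thesis using assms(2) unfolding X_fin_def
    by (auto intro!: bexI[of _ m] simp: Suc_diff_le)
qed

lemma L_fin_is_graph:
  assumes "0 < c 0"
  shows "e \<in> L_fin c n \<Longrightarrow> e \<subseteq> X_fin c n \<and> card e = 2"
proof (induction n arbitrary: e)
  case 0
  then show ?case using path_edges_in_X_fin by auto
next
  case (Suc n)
  have s: "s_seq c n @ [j] \<in> X_fin c (Suc n)" if "j < 2" for j
    using that s_seq_in_X_fin[of c n] assms append_in_X_fin by blast
  have ne: "s_seq c n \<noteq> []" by (simp add: s_seq_def)
  have p: "[k] \<in> X_fin c (Suc n)" if "k \<le> c (Suc n)" for k
    using that by (auto simp: X_fin_def intro!: bexI[of _ "Suc n"])
  consider v0 v1 j where "e = {v0 @ [j], v1 @ [j]}" "j < 2" "{v0, v1} \<in> L_fin c n"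
    | "e \<in> path_edges (c (Suc n))"
    | "e = {s_seq c n @ [0], [0]}" | "e = {[c (Suc n)], s_seq c n @ [1]}"
    using Suc.prems by auto
  then show ?case
  proof cases
    case 1
    then have "{v0, v1} \<subseteq> X_fin c n" "card {v0, v1} = 2" using Suc.IH by blast+
    then show ?thesis using 1 append_in_X_fin by (auto simp: card_insert_if split: if_splits)
  next
    case 2
    then show ?thesis using path_edges_in_X_fin by blast
  next
    case 3
    then show ?thesis using s[of 0] p[of 0] ne by (auto simp: card_insert_if)
  next
    case 4
    then show ?thesis using s[of 1] p[of "c (Suc n)"] ne by (auto simp: card_insert_if)
  qed
qed

lemma pi_in_X_fin:
  assumes "x \<in> X_lim c" "fst x \<le> n"
  shows "pi_fin n x \<in> X_fin c n"
proof -
  obtain m k r where x: "x = (m, k, r)" by (cases x)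
  then have "m \<le> n" "k \<le> c m" "range r \<subseteq> {0, 1}" using assms by (auto simp: X_lim_def)
  moreover from this have "set (map r [0..<n - m]) \<subseteq> {0, 1}" by (metis image_mono set_map subset_UNIV order_trans)
  ultimately show ?thesis unfolding x X_fin_def pi_fin_def by (auto intro!: bexI[of _ m])
qed

lemma graph_on_L\<^sub>0: "graph_on X\<^sub>0 L\<^sub>0"
proof -
  have "irrefl L\<^sub>0"
  proof (rule irreflI)
    fix x show "(x, x) \<notin> L\<^sub>0"
    proof
      assume "(x, x) \<in> L\<^sub>0"
      then have "{pi_fin (fst x) x, pi_fin (fst x) x} \<in> L_fin c\<^sub>0 (fst x)"
        by (auto simp: L\<^sub>0_def L_lim_def)
      moreover have "0 < c\<^sub>0 0" by (simp add: c\<^sub>0_def)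
      ultimately have "card {pi_fin (fst x) x, pi_fin (fst x) x} = 2" using L_fin_is_graph by blast
      then show False by simp
    qed
  qed
  then show ?thesis
    by (auto simp: graph_on_def L\<^sub>0_def X\<^sub>0_def L_lim_def sym_def insert_commute max.commute)
qed

end

theory Submission imports Defs "HOL-Probability.Probability" begin

text \<open>If a set \<open>A\<close> has no \<open>G\<close>-walk of odd length between its points, then separating points at even from
  points at odd distance shows that \<open>A\<close> lies in an invariant Borel set on which \<open>G\<close> is Borel
  2-colourable. Discarding all such sets for the countably many finite approximations of
  walks leaves approximations of which two realizations can always be joined by an odd walk. Iterating
  this yields paths consisting of two copies of the previous path, one of them reversed, joined by a path of
  odd but uncontrolled length. To map \<open>L\<^sub>0\<close> into their limit, one passes to the next path only when the
  connecting paths of \<open>L\<^sub>0\<close> have become at least as long; until then copies are mapped alternately forwards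
  and reflected.

  Conversely, a 2-colouring of \<open>L\<^sub>0\<close> changes its value whenever a single bit of a point \<open>(0, 0, r)\<close> is
  flipped, which no Borel set does.\<close>

text \<open>Two obstacles shape the limit. \<open>G\<close> need not be closed, so convergence of
  the vertices does not by itself put a limit of edges into \<open>G\<close>; hence edges carry
  codes as well, and every approximation fixes digits of both kinds of codes. Moreover, a target
  path is usually too long to be used when it is found, yet a map that waits must still send the two
  copies of a vertex of \<open>L\<^sub>0\<close> to positions of opposite parity. Reflection
  achieves this, as every target path has an odd number of edges. That reflection does not destroy
  convergence is due to the reversed copy: an odd walk joins the first vertices of two realizations,
  so one of them is traversed backwards, and the new path is symmetric on its two copies up to the
  digits already fixed. Reflection exchanges the copies and changes at most the newest
  digit.\<close>

section \<open>Analytic sets and separation\<close>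

text \<open>Unlike \<^const>\<open>analytic_set\<close>, the following notion admits the empty set; closed domains spare
  the retractions of Baire space onto them.\<close>

definition suslin :: "'a::topological_space set \<Rightarrow> bool" where
  "suslin A \<longleftrightarrow> (\<exists>F (f :: (nat \<Rightarrow> nat) \<Rightarrow> 'a). closed F \<and> continuous_on F f \<and> f ` F = A)"

lemma suslinI: "closed F \<Longrightarrow> continuous_on F f \<Longrightarrow> f ` F = A \<Longrightarrow> suslin A"
  for f :: "(nat \<Rightarrow> nat) \<Rightarrow> 'a::topological_space"
  unfolding suslin_def by blast

lemma suslinE:
  assumes "suslin A"
  obtains F and f :: "(nat \<Rightarrow> nat) \<Rightarrow> 'a::topological_space"
  where "closed F" "continuous_on F f" "A = f ` F"
  using assms unfolding suslin_def by blast

lemma suslin_image: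
  assumes "suslin A" "continuous_on A g"
  shows "suslin (g ` A)"
proof -
  obtain F and f :: "(nat \<Rightarrow> nat) \<Rightarrow> 'a" where f: "closed F" "continuous_on F f" "A = f ` F"
    using assms(1) by (rule suslinE)
  have "continuous_on F (g \<circ> f)" using f assms(2) by (intro continuous_on_compose) auto
  with f(1) show ?thesis by (rule suslinI) (simp add: f(3) image_image)
qed

lemma suslin_Int_closed:
  assumes "suslin A" "closed C"
  shows "suslin (A \<inter> C)"
proof -
  obtain F and f :: "(nat \<Rightarrow> nat) \<Rightarrow> 'a" where f: "closed F" "continuous_on F f" "A = f ` F"
    using assms(1) by (rule suslinE)
  have "closed (F \<inter> f -` C)"
    using f assms(2) continuous_closed_preimage by blast
  moreover have "continuous_on (F \<inter> f -` C) f" using f continuous_on_subset by blast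
  moreover have "f ` (F \<inter> f -` C) = A \<inter> C" using f by blast
  ultimately show ?thesis by (rule suslinI)
qed

lemma continuous_on_coord: "continuous_on S (\<lambda>x :: 'i \<Rightarrow> 'c::topological_space. x i)"
  by (rule continuous_on_subset[OF continuous_on_product_coordinates]) simp

lemma continuous_on_reindex:
  "continuous_on S (\<lambda>x :: 'i \<Rightarrow> 'c::topological_space. \<lambda>k. x (g k))"
  by (rule continuous_on_coordinatewise_then_product) (rule continuous_on_coord)

lemma closed_coord_eq: "closed {x :: nat \<Rightarrow> nat. x i = k}"
  by (rule closed_Collect_eq[OF continuous_on_coord continuous_on_const])

lemma open_coord_eq: "open {x :: nat \<Rightarrow> nat. x i = k}"
proof -
  have "open ((\<lambda>x :: nat \<Rightarrow> nat. x i) -` {k})"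
    by (rule open_vimage) (rule discrete_topology_class.open_discrete, rule continuous_on_coord)
  moreover have "(\<lambda>x :: nat \<Rightarrow> nat. x i) -` {k} = {x. x i = k}" by auto
  ultimately show ?thesis by simp
qed

text \<open>One digit decides membership in a piece \<open>{x. x i = k}\<close>, so the pieces are
  open and continuity may be checked on each separately. This glues countably many parametrizations
  into one.\<close>

lemma continuous_on_coord_cases:
  fixes f :: "nat \<Rightarrow> (nat \<Rightarrow> nat) \<Rightarrow> 'b::topological_space"
  assumes "\<And>k. continuous_on (S \<inter> {x. x i = k}) (f k)"
  shows "continuous_on S (\<lambda>x. f (x i) x)"
  unfolding continuous_on_open_invariant
proof (intro allI impI)
  fix B :: "'b set" assume B: "open B"
  have "\<forall>k. \<exists>A. open A \<and> A \<inter> (S \<inter> {x. x i = k}) = f k -` B \<inter> (S \<inter> {x. x i = k})"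
    using assms B unfolding continuous_on_open_invariant by blast
  then obtain A where A: "\<And>k. open (A k)"
    "\<And>k. A k \<inter> (S \<inter> {x. x i = k}) = f k -` B \<inter> (S \<inter> {x. x i = k})" by metis
  have "open (\<Union>k. A k \<inter> {x. x i = k})"
    using A(1) by (intro open_UN ballI open_Int open_coord_eq) auto
  moreover have "(\<Union>k. A k \<inter> {x. x i = k}) \<inter> S = (\<lambda>x. f (x i) x) -` B \<inter> S"
    using A(2) by blast
  ultimately show "\<exists>A. open A \<and> A \<inter> S = (\<lambda>x. f (x i) x) -` B \<inter> S" by blast
qed

lemma closed_coord_cases:
  assumes "\<And>k. closed (F k)"
  shows "closed {x :: nat \<Rightarrow> nat. x \<in> F (x i)}"
proof -
  have "- {x :: nat \<Rightarrow> nat. x \<in> F (x i)} = (\<Union>k. {x. x i = k} \<inter> - F k)" by auto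
  moreover have "open (\<Union>k. {x. x i = k} \<inter> - F k)"
    using assms by (intro open_UN ballI open_Int open_coord_eq) auto
  ultimately show ?thesis by (simp add: closed_def)
qed

lemma suslin_UN:
  fixes A :: "nat \<Rightarrow> 'a::topological_space set"
  assumes "\<And>n. suslin (A n)"
  shows "suslin (\<Union>n. A n)"
proof -
  have "\<forall>n. \<exists>F (f :: (nat \<Rightarrow> nat) \<Rightarrow> 'a). closed F \<and> continuous_on F f \<and> f ` F = A n"
    using assms unfolding suslin_def by blast
  then obtain F and f :: "nat \<Rightarrow> (nat \<Rightarrow> nat) \<Rightarrow> 'a" where
    f: "\<And>n. closed (F n)" "\<And>n. continuous_on (F n) (f n)" "\<And>n. f n ` F n = A n" by metis
  \<comment> \<open>Digit 0 selects the set, the shifted sequence is the point of the selected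
    domain.\<close>
  define sh where "sh = (\<lambda>x :: nat \<Rightarrow> nat. \<lambda>k. x (Suc k))"
  have sh: "continuous_on S sh" for S unfolding sh_def by (rule continuous_on_reindex)
  let ?F = "{x. x \<in> sh -` F (x 0)}"
  show ?thesis
  proof (rule suslinI)
    show "closed ?F" by (rule closed_coord_cases) (intro closed_vimage f(1) sh)
    have "continuous_on (?F \<inter> {x. x 0 = k}) (\<lambda>x. f k (sh x))" for k
      by (rule continuous_on_compose2[OF f(2)[of k] sh]) auto
    then show "continuous_on ?F (\<lambda>x. f (x 0) (sh x))"
      by (rule continuous_on_coord_cases[where f = "\<lambda>k x. f k (sh x)"])
    show "(\<lambda>x. f (x 0) (sh x)) ` ?F = (\<Union>n. A n)"
    proof safe
      fix x assume "sh x \<in> F (x 0)" then show "f (x 0) (sh x) \<in> (\<Union>n. A n)" using f(3) by blast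
    next
      fix n a assume "a \<in> A n"
      then obtain y where y: "y \<in> F n" "a = f n y" using f(3) by blast
      have "sh (case_nat n y) = y" by (simp add: sh_def)
      then show "a \<in> (\<lambda>x. f (x 0) (sh x)) ` ?F"
        using y by (intro image_eqI[of _ _ "case_nat n y"]) auto
    qed
  qed
qed

lemma suslin_empty: "suslin {}"
  by (rule suslinI[of "{}" "\<lambda>_. undefined"]) auto

text \<open>Splits one point of Baire space into countably many independent ones, so that pairs,
  sequences and whole walks of codes become single codes.\<close>

definition track :: "(nat \<Rightarrow> nat) \<Rightarrow> nat \<Rightarrow> nat \<Rightarrow> nat" where
  "track x n = (\<lambda>k. x (prod_encode (n, k)))"

lemma continuous_on_track: "continuous_on S (\<lambda>x. track x n)"
  unfolding track_def by (rule continuous_on_reindex)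

lemma track_surj: obtains x where "\<And>n. track x n = y n"
proof
  show "track (\<lambda>j. y (fst (prod_decode j)) (snd (prod_decode j))) n = y n" for n
    by (simp add: track_def)
qed

lemma suslin_INT:
  fixes A :: "nat \<Rightarrow> 'a::t2_space set"
  assumes "\<And>n. suslin (A n)"
  shows "suslin (\<Inter>n. A n)"
proof -
  have "\<forall>n. \<exists>F (f :: (nat \<Rightarrow> nat) \<Rightarrow> 'a). closed F \<and> continuous_on F f \<and> f ` F = A n"
    using assms unfolding suslin_def by blast
  then obtain F and f :: "nat \<Rightarrow> (nat \<Rightarrow> nat) \<Rightarrow> 'a" where
    f: "\<And>n. closed (F n)" "\<And>n. continuous_on (F n) (f n)" "\<And>n. f n ` F n = A n" by metis
  define T where "T = (\<Inter>n. (\<lambda>x. track x n) -` F n)"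
  have T: "closed T" unfolding T_def by (intro closed_INT ballI closed_vimage f(1) continuous_on_track)
  have c: "continuous_on T (\<lambda>x. f n (track x n))" for n
    by (rule continuous_on_compose2[OF f(2)[of n] continuous_on_track]) (auto simp: T_def)
  \<comment> \<open>A point of the intersection is coded by one code for each set, all with the same
    value; in a Hausdorff space such agreement is a closed condition.\<close>
  have cl: "closed {x \<in> T. f n (track x n) = f 0 (track x 0)}" for n
  proof -
    have "closed (T \<inter> (\<lambda>x. (f n (track x n), f 0 (track x 0))) -` {z. fst z = snd z})"
      by (intro continuous_closed_preimage continuous_on_Pair c T closed_Collect_eq continuous_intros)
    moreover have "T \<inter> (\<lambda>x. (f n (track x n), f 0 (track x 0))) -` {z. fst z = snd z} =
        {x \<in> T. f n (track x n) = f 0 (track x 0)}" by auto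
    ultimately show ?thesis by simp
  qed
  show ?thesis
  proof (rule suslinI)
    show "closed (\<Inter>n. {x \<in> T. f n (track x n) = f 0 (track x 0)})" using cl by (intro closed_INT) auto
    show "continuous_on (\<Inter>n. {x \<in> T. f n (track x n) = f 0 (track x 0)}) (\<lambda>x. f 0 (track x 0))"
      by (rule continuous_on_subset[OF c]) auto
    show "(\<lambda>x. f 0 (track x 0)) ` (\<Inter>n. {x \<in> T. f n (track x n) = f 0 (track x 0)}) = (\<Inter>n. A n)"
    proof safe
      fix x n assume x: "x \<in> (\<Inter>n. {x \<in> T. f n (track x n) = f 0 (track x 0)})"
      then have "f n (track x n) = f 0 (track x 0)" "track x n \<in> F n" unfolding T_def by auto
      then show "f 0 (track x 0) \<in> A n" using f(3) by (metis imageI)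
    next
      fix a assume "a \<in> (\<Inter>n. A n)"
      then have "a \<in> f n ` F n" for n using f(3)[of n] by auto
      then have "\<forall>n. \<exists>y. y \<in> F n \<and> f n y = a" by (metis imageE)
      then obtain y where y: "\<And>n. y n \<in> F n" "\<And>n. f n (y n) = a" by metis
      obtain x where "\<And>n. track x n = y n" using track_surj by blast
      then show "a \<in> (\<lambda>x. f 0 (track x 0)) ` (\<Inter>n. {x \<in> T. f n (track x n) = f 0 (track x 0)})"
        using y by (intro image_eqI[of _ _ x]) (auto simp: T_def)
    qed
  qed
qed

lemma suslin_Times:
  fixes A :: "'a::topological_space set" and B :: "'b::topological_space set"
  assumes "suslin A" "suslin B"
  shows "suslin (A \<times> B)"
proof -
  obtain F and f :: "(nat \<Rightarrow> nat) \<Rightarrow> 'a" where f: "closed F" "continuous_on F f" "A = f ` F"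
    using assms(1) by (rule suslinE)
  obtain K and g :: "(nat \<Rightarrow> nat) \<Rightarrow> 'b" where g: "closed K" "continuous_on K g" "B = g ` K"
    using assms(2) by (rule suslinE)
  let ?T = "(\<lambda>x. track x 0) -` F \<inter> (\<lambda>x. track x 1) -` K"
  show ?thesis
  proof (rule suslinI)
    show "closed ?T" by (intro closed_Int closed_vimage f g continuous_on_track)
    show "continuous_on ?T (\<lambda>x. (f (track x 0), g (track x 1)))"
      by (intro continuous_on_Pair continuous_on_compose2[OF f(2) continuous_on_track]
          continuous_on_compose2[OF g(2) continuous_on_track]) auto
    show "(\<lambda>x. (f (track x 0), g (track x 1))) ` ?T = A \<times> B"
    proof safe
      fix a b assume "a \<in> A" "b \<in> B"
      then obtain y z where yz: "y \<in> F" "a = f y" "z \<in> K" "b = g z" using f g by blast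
      obtain x where "\<And>n. track x n = (if n = 0 then y else z)"
        using track_surj[of "\<lambda>n. if n = 0 then y else z"] by blast
      then show "(a, b) \<in> (\<lambda>x. (f (track x 0), g (track x 1))) ` ?T"
        using yz by (intro image_eqI[of _ _ x]) auto
    qed (use f g in auto)
  qed
qed

section \<open>Cylinders, and Borel subsets of analytic sets\<close>

definition cyl :: "nat list \<Rightarrow> (nat \<Rightarrow> nat) set" where
  "cyl s = {x. \<forall>i < length s. x i = s ! i}"

lemma cyl_map: "cyl (map x [0..<n]) = {y. \<forall>i<n. y i = x i}"
  by (auto simp: cyl_def)

lemma open_cyl: "open (cyl s)"
proof -
  have "cyl s = (\<Inter>i\<in>{..<length s}. {x. x i = s ! i})" by (auto simp: cyl_def)
  then show ?thesis by (simp add: open_INT open_coord_eq)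
qed

lemma closed_cyl: "closed (cyl s)"
proof -
  have "cyl s = (\<Inter>i\<in>{..<length s}. {x. x i = s ! i})" by (auto simp: cyl_def)
  then show ?thesis by (simp add: closed_INT closed_coord_eq)
qed

lemma cyl_snoc: "x \<in> cyl (s @ [k]) \<longleftrightarrow> x \<in> cyl s \<and> x (length s) = k"
  by (auto simp: cyl_def nth_append less_Suc_eq)

lemma cyl_Un: "cyl s = (\<Union>k. cyl (s @ [k]))"
  by (auto simp: cyl_snoc)

lemma cyl_basis:
  assumes "open U" "x \<in> U"
  shows "\<exists>n. cyl (map x [0..<n]) \<subseteq> U"
proof -
  obtain X where X: "x \<in> Pi\<^sub>E UNIV X" "finite {i. X i \<noteq> topspace euclidean}" "Pi\<^sub>E UNIV X \<subseteq> U"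
    using product_topology_open_contains_basis[of "\<lambda>_. euclidean" UNIV U x] assms
    unfolding open_fun_def by blast
  obtain n where n: "\<And>i. X i \<noteq> UNIV \<Longrightarrow> i < n"
    using X(2) unfolding topspace_euclidean finite_nat_set_iff_bounded by auto
  have "cyl (map x [0..<n]) \<subseteq> Pi\<^sub>E UNIV X"
  proof
    fix y assume y: "y \<in> cyl (map x [0..<n])"
    have "y i \<in> X i" for i
    proof (cases "i < n")
      case True then show ?thesis using y X(1) by (auto simp: cyl_map)
    next
      case False then show ?thesis using n[of i] by auto
    qed
    then show "y \<in> Pi\<^sub>E UNIV X" by auto
  qed
  then show ?thesis using X by blast
qed

text \<open>The preimage of an open set is relatively open in the domain, hence the trace of
  countably many cylinders. These are also closed and thus cut the domain into closed
  pieces.\<close>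

lemma suslin_Int_open:
  assumes "suslin A" "open U"
  shows "suslin (A \<inter> U)"
proof -
  obtain F and f :: "(nat \<Rightarrow> nat) \<Rightarrow> 'a" where f: "closed F" "continuous_on F f" "A = f ` F"
    using assms(1) by (rule suslinE)
  obtain V where V: "open V" "f -` U \<inter> F = V \<inter> F"
    using f(2) assms(2) unfolding continuous_on_open_invariant by metis
  define C where "C = (\<lambda>k. if cyl (from_nat k) \<subseteq> V then cyl (from_nat k) else {})"
  have "V = (\<Union>k. C k)"
  proof safe
    fix x assume "x \<in> V"
    then obtain n where "cyl (map x [0..<n]) \<subseteq> V" using cyl_basis V(1) by blast
    then have "x \<in> C (to_nat (map x [0..<n]))" by (auto simp: C_def cyl_map)
    then show "x \<in> (\<Union>k. C k)" by blast
  qed (auto simp: C_def split: if_splits)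
  then have "A \<inter> U = (\<Union>k. f ` (F \<inter> C k))" using V f by blast
  moreover have "suslin (f ` (F \<inter> C k))" for k
  proof (rule suslinI)
    show "closed (F \<inter> C k)" using f closed_cyl by (auto simp: C_def)
    show "continuous_on (F \<inter> C k) f" by (rule continuous_on_subset[OF f(2)]) simp
  qed simp
  ultimately show ?thesis using suslin_UN by metis
qed

lemma suslin_Int_borel:
  fixes A :: "'a::t2_space set"
  assumes "B \<in> sets borel" "suslin A"
  shows "suslin (A \<inter> B)"
proof -
  have "B \<in> sigma_sets UNIV {S. open S}" using assms(1) by (simp add: sets_borel)
  \<comment> \<open>Intersection and difference are carried along together: complements exchange the
    two, and for a countable union the difference becomes a countable intersection.\<close>
  then have "\<forall>A. suslin A \<longrightarrow> suslin (A \<inter> B) \<and> suslin (A - B)"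
  proof induction
    case (Basic U)
    then show ?case using suslin_Int_open suslin_Int_closed[of _ "- U"]
      by (auto simp: Diff_eq closed_Compl)
  next
    case Empty
    then show ?case by (simp add: suslin_empty)
  next
    case (Compl B)
    then show ?case by (auto simp: Diff_Int_distrib Int_Diff Diff_eq)
  next
    case (Union B)
    have "suslin (A \<inter> \<Union> (range B)) \<and> suslin (A - \<Union> (range B))" if "suslin A" for A
    proof -
      have "A \<inter> \<Union> (range B) = (\<Union>n. A \<inter> B n)" "A - \<Union> (range B) = (\<Inter>n. A - B n)" by auto
      then show ?thesis using suslin_UN[of "\<lambda>n. A \<inter> B n"] suslin_INT[of "\<lambda>n. A - B n"] Union that
        by metis
    qed
    then show ?case by blast
  qed
  then show ?thesis using assms(2) by blast
qed

lemma suslin_Image: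
  fixes H :: "('a::t2_space \<times> 'a) set"
  assumes "suslin H" "suslin S"
  shows "suslin (H `` S)"
proof -
  have "suslin ((S \<times> H) \<inter> {z. fst z = fst (snd z)})"
    by (intro suslin_Int_closed suslin_Times assms closed_Collect_eq continuous_intros)
  then have "suslin ((snd \<circ> snd) ` ((S \<times> H) \<inter> {z. fst z = fst (snd z)}))"
    by (rule suslin_image) (intro continuous_intros)
  moreover have "(snd \<circ> snd) ` ((S \<times> H) \<inter> {z. fst z = fst (snd z)}) = H `` S"
    by (force simp: image_iff)
  ultimately show ?thesis by simp
qed

lemma suslin_rtrancl_Image:
  fixes H :: "('a::t2_space \<times> 'a) set"
  assumes "suslin H" "suslin S"
  shows "suslin (H\<^sup>* `` S)"
proof -
  have "suslin ((H ^^ n) `` S)" for n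
  proof (induction n)
    case (Suc n)
    have "(H ^^ Suc n) `` S = H `` ((H ^^ n) `` S)" by auto
    then show ?case using suslin_Image Suc assms by simp
  qed (simp add: assms)
  then have "suslin (\<Union>n. (H ^^ n) `` S)" by (rule suslin_UN)
  moreover have "(\<Union>n. (H ^^ n) `` S) = H\<^sup>* `` S" by (auto simp: rtrancl_is_UN_relpow)
  ultimately show ?thesis by simp
qed

section \<open>Separation of disjoint analytic sets by Borel sets\<close>

definition borel_separated :: "'a::topological_space set \<Rightarrow> 'a set \<Rightarrow> bool" where
  "borel_separated A B \<longleftrightarrow> (\<exists>C \<in> sets borel. A \<subseteq> C \<and> B \<inter> C = {})"

text \<open>Used contrapositively: if two countable unions cannot be separated, then neither can
  some pair of their pieces, which allows an unseparated pair to be refined forever.\<close>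

lemma borel_separated_UN:
  fixes A B :: "nat \<Rightarrow> 'a::topological_space set"
  assumes "\<And>i j. borel_separated (A i) (B j)"
  shows "borel_separated (\<Union>i. A i) (\<Union>j. B j)"
proof -
  define C where "C i j = (SOME C. C \<in> sets borel \<and> A i \<subseteq> C \<and> B j \<inter> C = {})" for i j
  have "C i j \<in> sets borel \<and> A i \<subseteq> C i j \<and> B j \<inter> C i j = {}" for i j
    unfolding C_def using assms[of i j] unfolding borel_separated_def Bex_def by (rule someI_ex)
  then have C: "C i j \<in> sets borel" "A i \<subseteq> C i j" "B j \<inter> C i j = {}" for i j by auto
  have "(\<Union>i. \<Inter>j. C i j) \<in> sets borel" using C(1) by auto
  moreover have "(\<Union>i. A i) \<subseteq> (\<Union>i. \<Inter>j. C i j)" using C(2) by blast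
  moreover have "(\<Union>j. B j) \<inter> (\<Union>i. \<Inter>j. C i j) = {}" using C(3) by blast
  ultimately show ?thesis unfolding borel_separated_def by blast
qed

lemma lists_limit:
  fixes s :: "nat \<Rightarrow> 'a list"
  assumes "s 0 = []" "\<And>n. \<exists>k. s (Suc n) = s n @ [k]"
  obtains x where "\<And>n. s n = map x [0..<n]"
proof -
  have len: "length (s n) = n" for n
    by (induction n) (use assms in \<open>auto, metis length_append_singleton\<close>)
  have "s n = map (\<lambda>i. s (Suc i) ! i) [0..<n]" for n
  proof (induction n)
    case (Suc n)
    obtain k where k: "s (Suc n) = s n @ [k]" using assms(2) by blast
    then have "s (Suc n) ! n = k" using len by (simp add: nth_append)
    then show ?case using k Suc by simp
  qed (simp add: assms)
  then show thesis using that by blast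
qed

text \<open>Lusin's separation theorem: were the sets not separated, one could shrink both parametrizations
  to cylinders around two points with distinct images while keeping them unseparated.\<close>

lemma lusin_separation:
  fixes A B :: "'a::t2_space set"
  assumes "suslin A" "suslin B" "A \<inter> B = {}"
  shows "borel_separated A B"
proof (rule ccontr)
  obtain F and f :: "(nat \<Rightarrow> nat) \<Rightarrow> 'a" where f: "closed F" "continuous_on F f" "A = f ` F"
    using assms(1) by (rule suslinE)
  obtain K and g :: "(nat \<Rightarrow> nat) \<Rightarrow> 'a" where g: "closed K" "continuous_on K g" "B = g ` K"
    using assms(2) by (rule suslinE)
  define bad where "bad = (\<lambda>(s, t). \<not> borel_separated (f ` (F \<inter> cyl s)) (g ` (K \<inter> cyl t)))"
  assume "\<not> borel_separated A B"
  then have bad0: "bad ([], [])" by (simp add: bad_def f g cyl_def)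
  have step: "\<exists>p'. bad p' \<and> (\<exists>k l. p' = (fst p @ [k], snd p @ [l]))" if "bad p" for p
  proof (rule ccontr)
    obtain s t where p: "p = (s, t)" by (cases p)
    assume "\<nexists>p'. bad p' \<and> (\<exists>k l. p' = (fst p @ [k], snd p @ [l]))"
    then have "borel_separated (f ` (F \<inter> cyl (s @ [k]))) (g ` (K \<inter> cyl (t @ [l])))" for k l
      by (auto simp: bad_def p)
    then have "borel_separated (\<Union>k. f ` (F \<inter> cyl (s @ [k]))) (\<Union>l. g ` (K \<inter> cyl (t @ [l])))"
      by (rule borel_separated_UN)
    moreover have "(\<Union>k. f ` (F \<inter> cyl (s @ [k]))) = f ` (F \<inter> cyl s)"
      "(\<Union>l. g ` (K \<inter> cyl (t @ [l]))) = g ` (K \<inter> cyl t)"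
      by (subst cyl_Un[of s], blast) (subst cyl_Un[of t], blast)
    ultimately show False using that by (simp add: bad_def p)
  qed
  define P where "P = rec_nat ([], []) (\<lambda>_ p. SOME p'. bad p' \<and> (\<exists>k l. p' = (fst p @ [k], snd p @ [l])))"
  have badP: "bad (P n)" for n
    by (induction n) (use bad0 someI_ex[OF step] in \<open>auto simp: P_def\<close>)
  have P: "\<exists>k l. P (Suc n) = (fst (P n) @ [k], snd (P n) @ [l])" for n
    using someI_ex[OF step[OF badP[of n]]] by (simp add: P_def)
  obtain x where x: "\<And>n. fst (P n) = map x [0..<n]"
    by (rule lists_limit[of "\<lambda>n. fst (P n)"]) (use P in \<open>auto simp: P_def, metis fst_conv\<close>)
  obtain y where y: "\<And>n. snd (P n) = map y [0..<n]"
    by (rule lists_limit[of "\<lambda>n. snd (P n)"]) (use P in \<open>auto simp: P_def, metis snd_conv\<close>)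
  have bad: "\<not> borel_separated (f ` (F \<inter> cyl (map x [0..<n]))) (g ` (K \<inter> cyl (map y [0..<n])))" for n
    using badP[of n] x[of n] y[of n] by (simp add: bad_def case_prod_beta)
  \<comment> \<open>Outside the closed \<open>F\<close>, some cylinder around \<open>x\<close> would
    miss \<open>F\<close>; its image would be empty and thus trivially separated. The same argument
    applies to \<open>y\<close>.\<close>
  have "x \<in> F"
  proof (rule ccontr)
    assume "x \<notin> F"
    then obtain n where "cyl (map x [0..<n]) \<subseteq> - F" using cyl_basis[of "- F" x] f(1) by blast
    then have "f ` (F \<inter> cyl (map x [0..<n])) = {}" by blast
    then show False using bad[of n] by (auto simp: borel_separated_def)
  qed
  have "y \<in> K"
  proof (rule ccontr)
    assume "y \<notin> K"
    then obtain n where "cyl (map y [0..<n]) \<subseteq> - K" using cyl_basis[of "- K" y] g(1) by blast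
    then have "g ` (K \<inter> cyl (map y [0..<n])) = {}" by blast
    then show False using bad[of n] by (auto simp: borel_separated_def)
  qed
  have "f x \<noteq> g y" using assms(3) \<open>x \<in> F\<close> \<open>y \<in> K\<close> f g by blast
  then obtain U V where UV: "open U" "open V" "f x \<in> U" "g y \<in> V" "U \<inter> V = {}" by (meson hausdorff)
  obtain U' where U': "open U'" "f -` U \<inter> F = U' \<inter> F"
    using f(2) UV(1) unfolding continuous_on_open_invariant by metis
  obtain V' where V': "open V'" "g -` V \<inter> K = V' \<inter> K"
    using g(2) UV(2) unfolding continuous_on_open_invariant by metis
  obtain n where n: "cyl (map x [0..<n]) \<subseteq> U'" using cyl_basis[of U' x] U' UV \<open>x \<in> F\<close> by blast
  obtain m where m: "cyl (map y [0..<m]) \<subseteq> V'" using cyl_basis[of V' y] V' UV \<open>y \<in> K\<close> by blast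
  have "cyl (map x [0..<max n m]) \<subseteq> cyl (map x [0..<n])"
    "cyl (map y [0..<max n m]) \<subseteq> cyl (map y [0..<m])" by (auto simp: cyl_map)
  then have "f ` (F \<inter> cyl (map x [0..<max n m])) \<subseteq> U"
    "g ` (K \<inter> cyl (map y [0..<max n m])) \<subseteq> V"
    using n m U'(2) V'(2) by blast+
  then have "borel_separated (f ` (F \<inter> cyl (map x [0..<max n m]))) (g ` (K \<inter> cyl (map y [0..<max n m])))"
    unfolding borel_separated_def using UV(1,5) by (intro bexI[of _ U]) (fast, simp)
  then show False using bad by blast
qed

section \<open>Borel 2-colourings\<close>

lemma suslin_UNIV_bool: "suslin (UNIV :: bool set)"
proof (rule suslinI)
  show "continuous_on UNIV (\<lambda>x :: nat \<Rightarrow> nat. x 0 = 0)"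
    by (rule continuous_on_coord_cases[where f = "\<lambda>k _. k = 0"]) (rule continuous_on_const)
  show "range (\<lambda>x :: nat \<Rightarrow> nat. x 0 = 0) = UNIV"
  proof (intro equalityI subsetI)
    fix b :: bool
    show "b \<in> range (\<lambda>x :: nat \<Rightarrow> nat. x 0 = 0)"
      by (rule image_eqI[of _ _ "\<lambda>_. if b then 0 else 1"]) auto
  qed simp
qed simp

text \<open>Abstracts the double cover of a graph, with \<open>\<tau>\<close> exchanging the sheets:
  a walk from \<open>x\<close> to \<open>\<tau> y\<close>, with \<open>x\<close> and
  \<open>y\<close> on the same sheet, stands for an odd walk between the points below them.\<close>

locale involutive_graph =
  fixes H :: "('b::t2_space \<times> 'b) set" and \<tau> :: "'b \<Rightarrow> 'b"
  assumes suslin_H: "suslin H" and sym_H: "sym H"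
    and continuous_\<tau>: "continuous_on UNIV \<tau>" and \<tau>_\<tau> [simp]: "\<tau> (\<tau> x) = x"
    and \<tau>_edge: "(x, y) \<in> H \<Longrightarrow> (\<tau> x, \<tau> y) \<in> H"
begin

definition \<tau>_free :: "'b set \<Rightarrow> bool" where
  "\<tau>_free S \<longleftrightarrow> (\<forall>x\<in>S. \<forall>y\<in>S. (x, \<tau> y) \<notin> H\<^sup>*)"

lemma \<tau>_path: "(x, y) \<in> H\<^sup>* \<Longrightarrow> (\<tau> x, \<tau> y) \<in> H\<^sup>*"
  by (induction rule: rtrancl_induct) (auto intro: rtrancl_into_rtrancl \<tau>_edge)

lemma path_sym: "(x, y) \<in> H\<^sup>* \<Longrightarrow> (y, x) \<in> H\<^sup>*"
  using sym_rtrancl[OF sym_H] by (rule symD)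

lemma \<tau>_Domain: "x \<in> Domain H \<Longrightarrow> \<tau> x \<in> Domain H"
  using \<tau>_edge by blast

lemma path_Domain: "T \<subseteq> Domain H \<Longrightarrow> H\<^sup>* `` T \<subseteq> Domain H"
proof safe
  fix x y assume "T \<subseteq> Domain H" "x \<in> T" "(x, y) \<in> H\<^sup>*"
  then show "y \<in> Domain H" by (metis DomainI path_sym converse_rtranclE subsetD)
qed

lemma suslin_Domain: "suslin (Domain H)"
  unfolding fst_eq_Domain[symmetric] by (rule suslin_image[OF suslin_H]) (intro continuous_intros)

lemma \<tau>_free_saturation: "\<tau>_free T \<Longrightarrow> \<tau>_free (H\<^sup>* `` T)"
  unfolding \<tau>_free_def
proof safe
  fix x y x' y' assume *: "\<forall>x\<in>T. \<forall>y\<in>T. (x, \<tau> y) \<notin> H\<^sup>*" "x' \<in> T" "(x', x) \<in> H\<^sup>*"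
    "(x, \<tau> y) \<in> H\<^sup>*" "y' \<in> T" "(y', y) \<in> H\<^sup>*"
  have "(\<tau> y, \<tau> y') \<in> H\<^sup>*" using *(6) path_sym \<tau>_path by blast
  then have "(x', \<tau> y') \<in> H\<^sup>*" using *(3,4) rtrancl_trans by meson
  then show False using * by blast
qed

lemma suslin_\<tau>_saturation: "suslin T \<Longrightarrow> suslin (\<tau> ` (H\<^sup>* `` T))"
  by (rule suslin_image[OF suslin_rtrancl_Image[OF suslin_H]])
    (auto intro: continuous_on_subset[OF continuous_\<tau>])

text \<open>Separation is applied twice. The first Borel set \<open>U\<close> avoids everything
  linked to \<open>S\<close> through \<open>\<tau>\<close>, but two points of \<open>U\<close> may
  still be linked to each other; the second set \<open>V\<close> avoids what is linked to
  \<open>U\<close>. Cutting down to \<open>Domain H\<close> keeps the sets analytic, as a Borel set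
  in an arbitrary Hausdorff space need not be.\<close>

lemma \<tau>_free_borel_superset:
  assumes S: "suslin S" "\<tau>_free S"
  shows "\<exists>B\<in>sets borel. S \<subseteq> B \<and> \<tau>_free (B \<inter> Domain H)"
proof -
  have "S \<inter> \<tau> ` (H\<^sup>* `` S) = {}"
    using S(2) unfolding \<tau>_free_def by fastforce
  then have "borel_separated S (\<tau> ` (H\<^sup>* `` S))"
    by (rule lusin_separation[OF S(1) suslin_\<tau>_saturation[OF S(1)]])
  then obtain U where U: "U \<in> sets borel" "S \<subseteq> U" "\<tau> ` (H\<^sup>* `` S) \<inter> U = {}"
    unfolding borel_separated_def by blast
  let ?T = "U \<inter> Domain H"
  have T: "suslin ?T" using suslin_Int_borel[OF U(1) suslin_Domain] by (subst Int_commute)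
  have "S \<inter> \<tau> ` (H\<^sup>* `` ?T) = {}"
  proof (rule ccontr)
    assume "S \<inter> \<tau> ` (H\<^sup>* `` ?T) \<noteq> {}"
    then obtain y z where yz: "\<tau> z \<in> S" "y \<in> ?T" "(y, z) \<in> H\<^sup>*" by blast
    then have "(\<tau> z, \<tau> y) \<in> H\<^sup>*" using path_sym \<tau>_path by blast
    then have "\<tau> (\<tau> y) \<in> \<tau> ` (H\<^sup>* `` S)" using yz(1) by blast
    then show False using U(3) yz(2) by auto
  qed
  then have "borel_separated S (\<tau> ` (H\<^sup>* `` ?T))"
    by (rule lusin_separation[OF S(1) suslin_\<tau>_saturation[OF T]])
  then obtain V where V: "V \<in> sets borel" "S \<subseteq> V" "\<tau> ` (H\<^sup>* `` ?T) \<inter> V = {}"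
    unfolding borel_separated_def by blast
  have "\<tau>_free (U \<inter> V \<inter> Domain H)"
    unfolding \<tau>_free_def
  proof (intro ballI notI)
    fix x y assume "x \<in> U \<inter> V \<inter> Domain H" "y \<in> U \<inter> V \<inter> Domain H" "(x, \<tau> y) \<in> H\<^sup>*"
    then have "\<tau> (\<tau> y) \<in> \<tau> ` (H\<^sup>* `` ?T)" "y \<in> V" by blast+
    then show False using V(3) by auto
  qed
  then show ?thesis using U V by (intro bexI[of _ "U \<inter> V"]) auto
qed

text \<open>A saturation is invariant but only analytic, a cover is Borel but need not be invariant.
  Alternating between them yields an increasing sequence on \<open>Domain H\<close> whose union has
  both properties there.\<close>

lemma \<tau>_free_invariant_borel_superset:
  assumes S: "suslin S" "\<tau>_free S" "S \<subseteq> Domain H"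
  shows "\<exists>B\<in>sets borel. S \<subseteq> B \<and> H `` B \<subseteq> B \<and> B \<inter> \<tau> ` B = {}"
proof -
  define good where "good T \<longleftrightarrow> suslin T \<and> \<tau>_free T \<and> T \<subseteq> Domain H" for T
  define cov where "cov T = (SOME B. B \<in> sets borel \<and> T \<subseteq> B \<and> \<tau>_free (B \<inter> Domain H))" for T
  have cov: "cov T \<in> sets borel \<and> T \<subseteq> cov T \<and> \<tau>_free (cov T \<inter> Domain H)" if "good T" for T
  proof -
    have "\<exists>B. B \<in> sets borel \<and> T \<subseteq> B \<and> \<tau>_free (B \<inter> Domain H)"
      using \<tau>_free_borel_superset[of T] that unfolding good_def Bex_def by simp
    then show ?thesis unfolding cov_def by (rule someI_ex)
  qed
  define Q where "Q = rec_nat S (\<lambda>_ T. H\<^sup>* `` (cov T \<inter> Domain H))"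
  have Q0: "Q 0 = S" and QS: "Q (Suc n) = H\<^sup>* `` (cov (Q n) \<inter> Domain H)" for n
    by (simp_all add: Q_def)
  have gQ: "good (Q n)" for n
  proof (induction n)
    case 0 then show ?case using S by (simp add: good_def Q0)
  next
    case (Suc n)
    note c = cov[OF Suc]
    have "suslin (cov (Q n) \<inter> Domain H)"
      using suslin_Int_borel[OF conjunct1[OF c] suslin_Domain] by (subst Int_commute)
    then show ?case unfolding QS good_def
      by (intro conjI suslin_rtrancl_Image[OF suslin_H] \<tau>_free_saturation path_Domain) (use c in auto)
  qed
  define B where "B n = cov (Q n)" for n
  have bB: "B n \<in> sets borel" and fB: "\<tau>_free (B n \<inter> Domain H)" and QB: "Q n \<subseteq> B n" for n
    using cov[OF gQ] unfolding B_def by blast+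
  have QD: "Q n \<subseteq> Domain H" for n using gQ good_def by blast
  have "B n \<inter> Domain H \<subseteq> B (Suc n) \<inter> Domain H" for n
    using QB[of "Suc n"] by (auto simp: QS B_def)
  then have mono: "B n \<inter> Domain H \<subseteq> B m \<inter> Domain H" if "n \<le> m" for n m
    using that by (rule lift_Suc_mono_le)
  define W where "W = (\<Union>n. B n)"
  have disj: "\<tau> x \<notin> W" if x: "x \<in> W" "x \<in> Domain H" for x
  proof
    assume "\<tau> x \<in> W"
    then obtain n m where nm: "x \<in> B n \<inter> Domain H" "\<tau> x \<in> B m \<inter> Domain H"
      using x \<tau>_Domain unfolding W_def by blast
    then have "x \<in> B (max n m) \<inter> Domain H" "\<tau> x \<in> B (max n m) \<inter> Domain H"
      using mono[of n "max n m"] mono[of m "max n m"] by (meson max.cobounded1 max.cobounded2 subsetD)+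
    then have "(x, \<tau> (\<tau> x)) \<notin> H\<^sup>*" using fB unfolding \<tau>_free_def by blast
    then show False by simp
  qed
  have "\<tau> \<in> borel_measurable borel" using continuous_\<tau> by (rule borel_measurable_continuous_onI)
  moreover have W: "W \<in> sets borel" unfolding W_def using bB by auto
  ultimately have \<tau>W: "\<tau> -` W \<in> sets borel" by (metis measurable_sets_borel)
  \<comment> \<open>Off \<open>Domain H\<close> nothing keeps \<open>W\<close> apart from its image
    under \<open>\<tau>\<close>, so the preimage of \<open>W\<close> is removed; by
    \<open>disj\<close> no point of \<open>Domain H\<close> is lost.\<close>
  show ?thesis
  proof (intro bexI conjI)
    show "S \<subseteq> W - \<tau> -` W" 
    proof
      fix x assume "x \<in> S"
      then have "x \<in> W" "x \<in> Domain H" using QB[of 0] S(3) unfolding W_def Q0 by blast+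
      then show "x \<in> W - \<tau> -` W" using disj by blast
    qed
    show "H `` (W - \<tau> -` W) \<subseteq> W - \<tau> -` W"
    proof safe
      fix x y assume xy: "x \<in> W" "(x, y) \<in> H"
      then obtain n where "x \<in> B n \<inter> Domain H" unfolding W_def by blast
      then have "y \<in> Q (Suc n)" unfolding QS using xy(2) by (auto simp: B_def)
      then have y: "y \<in> W" "y \<in> Domain H" using QB QD unfolding W_def by blast+
      show "y \<in> W" by fact
      show "\<tau> y \<in> W \<Longrightarrow> False" using disj y by blast
    qed
    show "(W - \<tau> -` W) \<inter> \<tau> ` (W - \<tau> -` W) = {}" by auto
    show "W - \<tau> -` W \<in> sets borel" using W \<tau>W by auto
  qed
qed

end

lemma continuous_on_Not: "continuous_on S Not"
  by (rule continuous_on_subset[of UNIV])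
    (auto intro: discrete_topology_class.open_discrete simp: continuous_on_open_vimage)

text \<open>Every edge changes the sheet, so walks from \<open>(x, False)\<close> to
  \<open>(y, True)\<close> are the lifts of the odd walks from \<open>x\<close> to
  \<open>y\<close>.\<close>

definition double_cover :: "('a \<times> 'a) set \<Rightarrow> (('a \<times> bool) \<times> ('a \<times> bool)) set" where
  "double_cover G = {((x, i), (y, \<not> i)) | x y i. (x, y) \<in> G}"

lemma double_cover_iff: "((x, i), (y, j)) \<in> double_cover G \<longleftrightarrow> (x, y) \<in> G \<and> j = (\<not> i)"
  by (auto simp: double_cover_def)

lemma involutive_graph_double_cover:
  fixes G :: "('a::t2_space \<times> 'a) set"
  assumes "suslin G" "sym G"
  shows "involutive_graph (double_cover G) (\<lambda>(x, i). (x, \<not> i))"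
proof
  have "suslin ((\<lambda>((x, y), i). ((x, i), (y, \<not> i))) ` (G \<times> UNIV))"
  proof (rule suslin_image[OF suslin_Times[OF assms(1) suslin_UNIV_bool]])
    show "continuous_on (G \<times> UNIV) (\<lambda>((x, y), i). ((x, i), (y, \<not> i)))"
      unfolding case_prod_beta
      by (intro continuous_intros continuous_on_compose2[OF continuous_on_Not]) auto
  qed
  moreover have "(\<lambda>((x, y), i). ((x, i), (y, \<not> i))) ` (G \<times> UNIV) = double_cover G"
    by (force simp: double_cover_def)
  ultimately show "suslin (double_cover G)" by simp
  show "sym (double_cover G)" using symD[OF assms(2)] by (auto simp: sym_def double_cover_iff)
  show "continuous_on UNIV (\<lambda>(x :: 'a, i). (x, \<not> i))"
    unfolding case_prod_beta
    by (intro continuous_intros continuous_on_compose2[OF continuous_on_Not]) auto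
qed (auto simp: double_cover_def)

definition borel_bipartite :: "('a::topological_space \<times> 'a) set \<Rightarrow> bool" where
  "borel_bipartite G \<longleftrightarrow> (\<exists>C\<in>sets borel. \<forall>(x, y)\<in>G. (x \<in> C) \<noteq> (y \<in> C))"

lemma borel_bipartiteI:
  assumes "C \<in> sets borel" "\<And>x y. (x, y) \<in> G \<Longrightarrow> x \<in> S \<Longrightarrow> y \<in> S \<Longrightarrow> (x \<in> C) \<noteq> (y \<in> C)"
  shows "borel_bipartite (G \<inter> S \<times> S)"
  unfolding borel_bipartite_def using assms by (intro bexI[of _ C]) auto

lemma borel_bipartiteD:
  assumes "borel_bipartite (G \<inter> S \<times> S)"
  shows "\<exists>C. C \<in> sets borel \<and> (\<forall>x y. (x, y) \<in> G \<longrightarrow> x \<in> S \<longrightarrow> y \<in> S \<longrightarrow> (x \<in> C) \<noteq> (y \<in> C))"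
  using assms unfolding borel_bipartite_def by fast

text \<open>The copy of \<open>A\<close> on one sheet is free for the exchange of sheets. The traces
  on the two sheets of an invariant Borel set around it are disjoint and exchanged by every edge:
  they are the colour classes.\<close>

lemma odd_walk_free_borel_superset:
  fixes G :: "('a::t2_space \<times> 'a) set"
  assumes G: "suslin G" "sym G" and A: "suslin A" "A \<subseteq> Domain G"
    and free: "\<And>x y. x \<in> A \<Longrightarrow> y \<in> A \<Longrightarrow> ((x, False), (y, True)) \<notin> (double_cover G)\<^sup>*"
  shows "\<exists>B\<in>sets borel. A \<subseteq> B \<and> G `` B \<subseteq> B \<and> borel_bipartite (G \<inter> B \<times> B)"
proof -
  interpret involutive_graph "double_cover G" "\<lambda>(x, i). (x, \<not> i)"
    using G by (rule involutive_graph_double_cover)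
  have "suslin ((\<lambda>x. (x, False)) ` A)" by (rule suslin_image[OF A(1)]) (intro continuous_intros)
  moreover have "(\<lambda>x. (x, False)) ` A \<subseteq> Domain (double_cover G)"
  proof safe
    fix x assume "x \<in> A"
    then obtain y where "(x, y) \<in> G" using A(2) by blast
    then have "((x, False), (y, True)) \<in> double_cover G" by (simp add: double_cover_iff)
    then show "(x, False) \<in> Domain (double_cover G)" by (rule DomainI)
  qed
  moreover have "\<tau>_free ((\<lambda>x. (x, False)) ` A)" using free by (auto simp: \<tau>_free_def)
  ultimately obtain B where B: "B \<in> sets borel" "(\<lambda>x. (x, False)) ` A \<subseteq> B"
    "double_cover G `` B \<subseteq> B" "B \<inter> (\<lambda>(x, i). (x, \<not> i)) ` B = {}"
    using \<tau>_free_invariant_borel_superset by metis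
  define P where "P i = {x. (x, i) \<in> B}" for i
  have "(\<lambda>x :: 'a. (x, i)) \<in> borel_measurable borel" for i :: bool
    by (intro borel_measurable_continuous_onI continuous_intros)
  then have "(\<lambda>x. (x, i)) -` B \<in> sets borel" for i using B(1) by (rule measurable_sets_borel)
  then have P: "P i \<in> sets borel" for i by (simp add: P_def vimage_def)
  have step: "y \<in> P (\<not> i)" if "x \<in> P i" "(x, y) \<in> G" for x y i
    using that B(3) double_cover_iff[of x i y "\<not> i" G] by (auto simp: P_def)
  have disj: "x \<notin> P False" if "x \<in> P True" for x
    using that B(4) by (force simp: P_def)
  have alt: "(x \<in> P True) \<noteq> (y \<in> P True)" if "(x, y) \<in> G" "x \<in> P False \<union> P True" for x y
    using step[OF _ that(1), of False] step[OF _ that(1), of True] disj[of x] disj[of y] that(2) by auto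
  show ?thesis
  proof (intro bexI conjI)
    show "A \<subseteq> P False \<union> P True" using B(2) by (auto simp: P_def)
    show "G `` (P False \<union> P True) \<subseteq> P False \<union> P True" using step[of _ False] step[of _ True] by auto
    show "borel_bipartite (G \<inter> (P False \<union> P True) \<times> (P False \<union> P True))"
      by (rule borel_bipartiteI[OF P[of True]]) (rule alt)
    show "P False \<union> P True \<in> sets borel" using P by auto
  qed
qed

section \<open>Discarding Borel 2-colourable invariant sets\<close>

text \<open>These sets act as the large ones: for symmetric \<open>G\<close> they are closed under
  countable intersections, and the empty set is among them exactly if \<open>G\<close> is Borel
  bipartite. By invariance no edge crosses the boundary, so colourings of different pieces can be
  combined.\<close>

definition residual :: "('a::topological_space \<times> 'a) set \<Rightarrow> 'a set \<Rightarrow> bool" where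
  "residual G Y \<longleftrightarrow> Y \<in> sets borel \<and> G `` Y \<subseteq> Y \<and> borel_bipartite (G \<inter> (- Y) \<times> (- Y))"

lemma residual_UNIV: "residual G UNIV"
  by (auto simp: residual_def borel_bipartite_def)

lemma residual_Diff:
  assumes "sym G" "residual G Y" "B \<in> sets borel" "G `` B \<subseteq> B" "borel_bipartite (G \<inter> B \<times> B)"
  shows "residual G (Y - B)"
proof -
  have "borel_bipartite (G \<inter> (- Y) \<times> (- Y))" using assms(2) by (simp add: residual_def)
  from borel_bipartiteD[OF this] obtain C where C: "C \<in> sets borel"
    "\<And>x y. (x, y) \<in> G \<Longrightarrow> x \<notin> Y \<Longrightarrow> y \<notin> Y \<Longrightarrow> (x \<in> C) \<noteq> (y \<in> C)" by auto
  from borel_bipartiteD[OF assms(5)] obtain P where P: "P \<in> sets borel"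
    "\<And>x y. (x, y) \<in> G \<Longrightarrow> x \<in> B \<Longrightarrow> y \<in> B \<Longrightarrow> (x \<in> P) \<noteq> (y \<in> P)" by auto
  have Y: "Y \<in> sets borel" "G `` Y \<subseteq> Y" using assms(2) unfolding residual_def by auto
  have iffs: "x \<in> Y \<longleftrightarrow> y \<in> Y" "x \<in> B \<longleftrightarrow> y \<in> B" if "(x, y) \<in> G" for x y
    using that symD[OF assms(1) that] Y(2) assms(4) by blast+
  show ?thesis unfolding residual_def
  proof (intro conjI)
    show "Y - B \<in> sets borel" using Y assms(3) by auto
    show "G `` (Y - B) \<subseteq> Y - B" using iffs by blast
    show "borel_bipartite (G \<inter> (- (Y - B)) \<times> (- (Y - B)))"
    proof (rule borel_bipartiteI)
      show "(B \<inter> P) \<union> (C - B) \<in> sets borel" using C P assms(3) by auto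
      fix x y assume xy: "(x, y) \<in> G" "x \<in> - (Y - B)" "y \<in> - (Y - B)"
      show "(x \<in> (B \<inter> P) \<union> (C - B)) \<noteq> (y \<in> (B \<inter> P) \<union> (C - B))"
        using P(2)[OF xy(1)] C(2)[OF xy(1)] iffs[OF xy(1)] xy(2,3) by (cases "x \<in> B") auto
    qed
  qed
qed

text \<open>A point outside the intersection is coloured according to the first \<open>Y n\<close>
  that it is not in. By invariance adjacent points have the same first index, so a single colouring
  is responsible for both.\<close>

lemma residual_INT:
  fixes Y :: "nat \<Rightarrow> 'a::topological_space set"
  assumes "sym G" "\<And>n. residual G (Y n)"
  shows "residual G (\<Inter>n. Y n)"
proof -
  have "borel_bipartite (G \<inter> (- Y n) \<times> (- Y n))" for n using assms(2) by (simp add: residual_def)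
  then have "\<forall>n. \<exists>C. C \<in> sets borel \<and>
      (\<forall>x y. (x, y) \<in> G \<longrightarrow> x \<in> - Y n \<longrightarrow> y \<in> - Y n \<longrightarrow> (x \<in> C) \<noteq> (y \<in> C))"
    by (intro allI borel_bipartiteD)
  from choice[OF this] obtain C where C: "\<And>n. C n \<in> sets borel"
    "\<And>n x y. (x, y) \<in> G \<Longrightarrow> x \<notin> Y n \<Longrightarrow> y \<notin> Y n \<Longrightarrow> (x \<in> C n) \<noteq> (y \<in> C n)" by auto
  have Y: "Y n \<in> sets borel" "G `` Y n \<subseteq> Y n" for n using assms(2) unfolding residual_def by auto
  have iffs: "x \<in> Y n \<longleftrightarrow> y \<in> Y n" if "(x, y) \<in> G" for x y n
    using that symD[OF assms(1) that] Y(2) by blast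
  define E where "E = (\<Union>n. C n \<inter> (\<Inter>m\<in>{..<n}. Y m) - Y n)"
  have E: "x \<in> E \<longleftrightarrow> x \<in> C n" if "x \<notin> Y n" "\<And>m. m < n \<Longrightarrow> x \<in> Y m" for x n
  proof
    assume "x \<in> E"
    then obtain k where k: "x \<in> C k" "\<And>m. m < k \<Longrightarrow> x \<in> Y m" "x \<notin> Y k" unfolding E_def by blast
    then have "k = n" using that by (metis linorder_neqE_nat)
    then show "x \<in> C n" using k by simp
  qed (use that in \<open>auto simp: E_def\<close>)
  show ?thesis unfolding residual_def
  proof (intro conjI)
    show "(\<Inter>n. Y n) \<in> sets borel" using Y(1) by auto
    show "G `` (\<Inter>n. Y n) \<subseteq> (\<Inter>n. Y n)" using iffs by blast
    show "borel_bipartite (G \<inter> (- (\<Inter>n. Y n)) \<times> (- (\<Inter>n. Y n)))"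
    proof (rule borel_bipartiteI)
      have "(\<Inter>m\<in>{..<n}. Y m) \<in> sets borel" for n
        by (cases "n = 0") (use Y in \<open>auto intro!: sets.finite_INT\<close>)
      then show "E \<in> sets borel" unfolding E_def using C(1) Y(1) by auto
      fix x y assume xy: "(x, y) \<in> G" "x \<in> - (\<Inter>n. Y n)"
      define k where "k = (LEAST n. x \<notin> Y n)"
      have "\<exists>n. x \<notin> Y n" using xy(2) by blast
      then have kx: "x \<notin> Y k" unfolding k_def by (rule LeastI_ex)
      have lx: "x \<in> Y m" if "m < k" for m using not_less_Least[OF that[unfolded k_def]] by blast
      have ky: "y \<notin> Y k" "\<And>m. m < k \<Longrightarrow> y \<in> Y m" using kx lx iffs[OF xy(1)] by blast+
      have "(x \<in> E) = (x \<in> C k)" by (rule E[OF kx lx])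
      moreover have "(y \<in> E) = (y \<in> C k)" by (rule E[OF ky])
      ultimately show "(x \<in> E) \<noteq> (y \<in> E)" using C(2)[OF xy(1) kx ky(1)] by simp
    qed
  qed
qed

section \<open>Coded walks\<close>

lemma track_map_surj: "\<exists>x. map (track x) [0..<length z] = z"
proof -
  obtain x where "\<And>n. track x n = z ! n" using track_surj[of "\<lambda>n. z ! n"] by blast
  then have "map (track x) [0..<length z] = z" by (intro nth_equalityI) auto
  then show ?thesis by blast
qed

definition restr :: "nat \<Rightarrow> (nat \<Rightarrow> nat) list \<Rightarrow> nat list list" where
  "restr m z = map (\<lambda>x. map x [0..<m]) z"

lemma length_restr [simp]: "length (restr m z) = length z"
  by (simp add: restr_def)

text \<open>\<open>u\<close> lists \<open>l\<close> edges and \<open>l - 1\<close> interior vertices of the connecting path; oddness of \<open>l\<close> is the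
  condition on \<open>length u = 2 * l - 1\<close>.\<close>

definition joined_copies :: "nat \<Rightarrow> nat list list \<Rightarrow> nat list list \<Rightarrow> bool" where
  "joined_copies m a a' \<longleftrightarrow> (\<exists>b0 u b1. a' = rev b0 @ u @ b1 \<and> length u mod 4 = 1 \<and>
     map (take m) b0 = a \<and> map (take m) b1 = a)"

lemma joined_copies_restr:
  assumes "length u mod 4 = 1" "restr m z0 = a" "restr m z1 = a"
  shows "joined_copies m a (restr (Suc m) (rev z0 @ u @ z1))"
proof -
  have t: "map (take m) (restr (Suc m) z) = restr m z" for z
    by (simp add: restr_def take_map comp_def)
  show ?thesis unfolding joined_copies_def
    by (intro exI[of _ "restr (Suc m) z0"] exI[of _ "restr (Suc m) u"] exI[of _ "restr (Suc m) z1"])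
      (simp only: t assms length_restr simp_thms, simp add: restr_def rev_map)
qed

locale coded_graph =
  fixes G :: "('a::t2_space \<times> 'a) set" and \<theta> :: "(nat \<Rightarrow> nat) \<Rightarrow> 'a \<times> 'a"
  assumes sym_G: "sym G" and continuous_\<theta>: "continuous_on UNIV \<theta>" and range_\<theta>: "range \<theta> = G"
begin

text \<open>Only edges are parametrized. A vertex is coded by any code of an edge leaving it, so
  exactly the points of \<open>Domain G\<close> have codes.\<close>

definition vtx :: "(nat \<Rightarrow> nat) \<Rightarrow> 'a" where
  "vtx y = fst (\<theta> y)"

definition adj :: "(nat \<Rightarrow> nat) \<Rightarrow> (nat \<Rightarrow> nat) \<Rightarrow> (nat \<Rightarrow> nat) \<Rightarrow> bool" where
  "adj y e y' \<longleftrightarrow> \<theta> e = (vtx y, vtx y') \<or> \<theta> e = (vtx y', vtx y)"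

text \<open>A walk in \<open>G\<close> is coded by the list of codes of its vertices (even positions) and edges
  (odd positions); edges are coded without orientation, so reversed lists code reversed walks.\<close>

definition coded_walk :: "(nat \<Rightarrow> nat) list \<Rightarrow> bool" where
  "coded_walk z \<longleftrightarrow> odd (length z) \<and>
     (\<forall>i. 2 * i + 2 < length z \<longrightarrow> adj (z ! (2 * i)) (z ! (2 * i + 1)) (z ! (2 * i + 2)))"

lemma continuous_on_vtx: "continuous_on S vtx"
  unfolding vtx_def by (intro continuous_on_fst continuous_on_subset[OF continuous_\<theta>]) simp

lemma vtx_edge: "\<theta> y \<in> G" "vtx y \<in> Domain G"
proof -
  show "\<theta> y \<in> G" using range_\<theta> by blast
  then show "vtx y \<in> Domain G" unfolding vtx_def by (metis DomainI prod.collapse)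
qed

lemma suslin_G: "suslin G"
  by (rule suslinI[OF closed_UNIV continuous_\<theta> range_\<theta>])

lemma adj_sym: "adj y e y' \<Longrightarrow> adj y' e y"
  by (auto simp: adj_def)

lemma coded_walk_nonempty: "coded_walk z \<Longrightarrow> z \<noteq> []"
  by (auto simp: coded_walk_def)

lemma coded_walk_rev:
  assumes "coded_walk z"
  shows "coded_walk (rev z)"
proof -
  obtain q where q: "length z = 2 * q + 1" using assms by (auto simp: coded_walk_def elim: oddE)
  have "adj (rev z ! (2 * i)) (rev z ! (2 * i + 1)) (rev z ! (2 * i + 2))" if i: "2 * i + 2 < length z" for i
  proof -
    define j where "j = q - i - 1"
    have j: "q = i + j + 1" using i q by (simp add: j_def)
    have "adj (z ! (2 * j)) (z ! (2 * j + 1)) (z ! (2 * j + 2))"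
      using assms i q j by (auto simp: coded_walk_def)
    then show ?thesis using i q j by (simp add: rev_nth adj_sym)
  qed
  then show ?thesis using assms by (simp add: coded_walk_def)
qed

text \<open>\<open>adj\<close> sees a vertex code only through \<open>vtx\<close>, so the vertex at
  the junction may be recoded. This matters because approximations prescribe digits of codes, and
  each copy has to keep its own.\<close>

lemma coded_walk_join:
  assumes w: "coded_walk (w @ [y])" and z: "coded_walk (y' # z)" and "vtx y = vtx y'" "vtx x = vtx y"
  shows "coded_walk (w @ x # z)"
proof -
  obtain k where k: "length w = 2 * k" using w by (auto simp: coded_walk_def elim: evenE)
  have adj_cong: "adj a' e' b'" if "adj a e b" "e = e'" "vtx a = vtx a'" "vtx b = vtx b'" for a b a' b' e e'
    using that by (simp add: adj_def)
  have "adj ((w @ x # z) ! (2 * i)) ((w @ x # z) ! (2 * i + 1)) ((w @ x # z) ! (2 * i + 2))"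
    if i: "2 * i + 2 < length (w @ x # z)" for i
  proof (cases "i < k")
    case True
    then have 1: "adj ((w @ [y]) ! (2 * i)) ((w @ [y]) ! (2 * i + 1)) ((w @ [y]) ! (2 * i + 2))"
      using w k by (auto simp: coded_walk_def)
    have "i + 1 < k \<or> k = i + 1" using True by auto
    then have 2: "vtx ((w @ [y]) ! (2 * i + 2)) = vtx ((w @ x # z) ! (2 * i + 2))"
      using k assms by (auto simp: nth_append)
    show ?thesis by (rule adj_cong[OF 1 _ _ 2]) (use True k in \<open>auto simp: nth_append\<close>)
  next
    case False
    then obtain j where j: "i = k + j" using le_Suc_ex linorder_not_less by blast
    then have "adj ((y' # z) ! (2 * j)) ((y' # z) ! (2 * j + 1)) ((y' # z) ! (2 * j + 2))"
      using z i k by (auto simp: coded_walk_def)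
    then have "adj ((x # z) ! (2 * j)) ((x # z) ! (2 * j + 1)) ((x # z) ! (2 * j + 2))"
      by (rule adj_cong) (use assms in \<open>auto simp: nth_Cons'\<close>)
    moreover have "(w @ x # z) ! (2 * i + d) = (x # z) ! (2 * j + d)" for d
    proof -
      have "2 * i + d = length w + (2 * j + d)" using j k by simp
      then show ?thesis by (simp only: nth_append_length_plus)
    qed
    from this[of 0] this[of 1] this[of 2] have "(w @ x # z) ! (2 * i) = (x # z) ! (2 * j)"
      "(w @ x # z) ! (2 * i + 1) = (x # z) ! (2 * j + 1)" "(w @ x # z) ! (2 * i + 2) = (x # z) ! (2 * j + 2)"
      by (simp_all only: add_0_right)
    ultimately show ?thesis by simp
  qed
  moreover have "odd (length (w @ x # z))" using k z by (simp add: coded_walk_def)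
  ultimately show ?thesis unfolding coded_walk_def by blast
qed

lemma coded_walk_single: "coded_walk [y]"
  by (simp add: coded_walk_def)

lemma coded_walk_edge:
  assumes "(vtx y, x) \<in> G"
  shows "\<exists>e y'. vtx y' = x \<and> coded_walk [y, e, y']"
proof -
  obtain e where e: "\<theta> e = (vtx y, x)" using assms range_\<theta> by (metis rangeE)
  obtain y' where y': "\<theta> y' = (x, vtx y)" using symD[OF sym_G assms] range_\<theta> by (metis rangeE)
  have x: "vtx y' = x" by (simp add: vtx_def y')
  have "adj y e y'" by (simp add: adj_def e x)
  then have "coded_walk [y, e, y']" by (auto simp: coded_walk_def less_Suc_eq)
  then show ?thesis using x by blast
qed

text \<open>\<open>w\<close> holds two codes for each edge traversed, so its length modulo 4 tells
  the parity of the walk, that is, whether the sheet has changed.\<close>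

lemma coded_walk_double_cover:
  assumes "((vtx y, i), (x, j)) \<in> (double_cover G)\<^sup>*"
  shows "\<exists>w y'. coded_walk (w @ [y']) \<and> hd (w @ [y']) = y \<and> vtx y' = x \<and>
    length w mod 4 = (if i = j then 0 else 2)"
  using assms
proof (induction rule: rtrancl_induct2)
  case refl
  show ?case by (intro exI[of _ "[]"] exI[of _ y]) (simp add: coded_walk_single)
next
  case (step x j x' j')
  then obtain w y' where w: "coded_walk (w @ [y'])" "hd (w @ [y']) = y" "vtx y' = x"
    "length w mod 4 = (if i = j then 0 else 2)" by blast
  have "(vtx y', x') \<in> G" "j' = (\<not> j)" using step w(3) by (auto simp: double_cover_iff)
  then obtain e y'' where e: "vtx y'' = x'" "coded_walk [y', e, y'']" using coded_walk_edge by blast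
  have "coded_walk (w @ y' # [e, y''])" by (rule coded_walk_join[OF w(1) e(2)]) auto
  moreover have "length (w @ [y', e]) mod 4 = (if i = j' then 0 else 2)"
    using w(4) \<open>j' = (\<not> j)\<close> by (cases i; cases j) (auto simp: mod_Suc)
  moreover have "hd (w @ [y', e, y'']) = y" using w(2) by (cases w) auto
  ultimately show ?case using e(1) by (intro exI[of _ "w @ [y', e]"] exI[of _ y'']) simp
qed

lemma coded_walk_last_invariant:
  assumes z: "coded_walk z" and Z: "G `` Z \<subseteq> Z" "vtx (hd z) \<in> Z"
  shows "vtx (last z) \<in> Z"
proof -
  have "vtx (z ! (2 * i)) \<in> Z" if "2 * i < length z" for i
    using that
  proof (induction i)
    case 0
    then show ?case using Z(2) by (simp add: hd_conv_nth)
  next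
    case (Suc i)
    then have "adj (z ! (2 * i)) (z ! (2 * i + 1)) (z ! (2 * i + 2))"
      using z by (simp add: coded_walk_def)
    then have "(vtx (z ! (2 * i)), vtx (z ! (2 * i + 2))) \<in> G"
      unfolding adj_def by (metis vtx_edge(1) symD[OF sym_G])
    then show ?case using Suc Z(1) by auto
  qed
  moreover obtain q where "length z = 2 * q + 1" using z by (auto simp: coded_walk_def elim: oddE)
  ultimately show ?thesis using coded_walk_nonempty[OF z] by (simp add: last_conv_nth)
qed

text \<open>\<open>G\<close> is Borel 2-colourable off a residual set, so dead approximations can be avoided.\<close>

definition dead :: "nat \<Rightarrow> nat list list \<Rightarrow> bool" where
  "dead m a \<longleftrightarrow> (\<exists>Y. residual G Y \<and> (\<forall>z. coded_walk z \<longrightarrow> restr m z = a \<longrightarrow> vtx (hd z) \<notin> Y))"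

section \<open>Approximations that survive the discarding\<close>

lemma not_dead_walk: "\<not> dead m a \<Longrightarrow> \<exists>z. coded_walk z \<and> restr m z = a"
  using residual_UNIV unfolding dead_def by blast

text \<open>Without any digits prescribed, every edge is a realization in either direction. A
  residual set that avoids all their first vertices meets no edge, so its complement carries a
  colouring of all of \<open>G\<close>.\<close>

lemma not_dead_root:
  assumes "\<not> borel_bipartite G"
  shows "\<not> dead 0 [[], [], []]"
proof
  assume "dead 0 [[], [], []]"
  then obtain Y where Y: "residual G Y"
    "\<And>z. coded_walk z \<Longrightarrow> restr 0 z = [[], [], []] \<Longrightarrow> vtx (hd z) \<notin> Y"
    unfolding dead_def by blast
  have "x \<notin> Y" if xx': "(x, x') \<in> G" for x x'
  proof -
    obtain y where y: "\<theta> y = (x, x')" using xx' range_\<theta> by (metis rangeE)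
    have x: "vtx y = x" by (simp add: vtx_def y)
    then obtain e y' where "coded_walk [y, e, y']" using xx' coded_walk_edge[of y x'] by auto
    then have "vtx (hd [y, e, y']) \<notin> Y" by (rule Y(2)) (simp add: restr_def)
    then show ?thesis using x by simp
  qed
  then have "G \<inter> (- Y) \<times> (- Y) = G" by (auto dest: symD[OF sym_G])
  then show False using assms Y(1) by (simp add: residual_def)
qed

text \<open>Merged into single points by \<open>track\<close>, the codes of the walks form a closed
  set: adjacency is an equality in a Hausdorff space, and prescribing finitely many digits is a
  closed condition.\<close>

lemma suslin_walk_start: "suslin {vtx (hd z) | z. coded_walk z \<and> restr m z = a}"
proof -
  let ?z = "\<lambda>x. map (track x) [0..<length a]"
  have hd: "hd (?z x) = track x 0" if "coded_walk (?z x)" for x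
    using coded_walk_nonempty[OF that] by (simp add: hd_map)
  define F where "F = {x. coded_walk (?z x) \<and> restr m (?z x) = a}"
  have "closed {x. adj (track x i) (track x j) (track x k)}" for i j k
    unfolding adj_def
    by (intro closed_Collect_disj closed_Collect_eq continuous_on_Pair
        continuous_on_compose2[OF continuous_\<theta> continuous_on_track]
        continuous_on_compose2[OF continuous_on_vtx continuous_on_track]) auto
  then have "closed {x. odd (length a) \<and>
      (\<forall>i. 2 * i + 2 < length a \<longrightarrow> adj (track x (2 * i)) (track x (2 * i + 1)) (track x (2 * i + 2)))}"
    by (intro closed_Collect_conj closed_Collect_const closed_Collect_all closed_Collect_imp open_Collect_const)
  moreover have "{x. coded_walk (?z x)} = {x. odd (length a) \<and>
      (\<forall>i. 2 * i + 2 < length a \<longrightarrow> adj (track x (2 * i)) (track x (2 * i + 1)) (track x (2 * i + 2)))}"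
    by (simp add: coded_walk_def)
  moreover have "closed {x. restr m (?z x) = a}"
  proof -
    have "{y. map y [0..<m] = s} = (if length s = m then cyl s else {})" for s :: "nat list"
      by (auto simp: cyl_def list_eq_iff_nth_eq)
    then have "closed {y. map y [0..<m] = s}" for s :: "nat list" by (simp add: closed_cyl)
    then have "closed (\<Inter>i\<in>{..<length a}. (\<lambda>x. track x i) -` {y. map y [0..<m] = a ! i})"
      by (intro closed_INT ballI closed_vimage continuous_on_track)
    moreover have "{x. restr m (?z x) = a} = (\<Inter>i\<in>{..<length a}. (\<lambda>x. track x i) -` {y. map y [0..<m] = a ! i})"
    proof -
      have "restr m (?z x) = a \<longleftrightarrow> (\<forall>i<length a. map (track x i) [0..<m] = a ! i)" for x
        by (subst list_eq_iff_nth_eq) (simp add: restr_def)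
      then show ?thesis by auto
    qed
    ultimately show ?thesis by simp
  qed
  ultimately have F: "closed F" unfolding F_def by (simp add: closed_Collect_conj)
  show ?thesis
  proof (rule suslinI[OF F])
    show "continuous_on F (\<lambda>x. vtx (track x 0))"
      by (rule continuous_on_compose2[OF continuous_on_vtx continuous_on_track]) auto
    show "(\<lambda>x. vtx (track x 0)) ` F = {vtx (hd z) | z. coded_walk z \<and> restr m z = a}"
    proof (intro equalityI subsetI)
      fix v assume "v \<in> (\<lambda>x. vtx (track x 0)) ` F"
      then obtain x where "v = vtx (track x 0)" "x \<in> F" by blast
      then show "v \<in> {vtx (hd z) | z. coded_walk z \<and> restr m z = a}"
        unfolding F_def using hd by (intro CollectI exI[of _ "?z x"]) simp
    next
      fix v assume "v \<in> {vtx (hd z) | z. coded_walk z \<and> restr m z = a}"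
      then obtain z where z: "coded_walk z" "restr m z = a" and v: "v = vtx (hd z)" by blast
      obtain x where x: "map (track x) [0..<length z] = z" using track_map_surj by blast
      moreover have la: "length a = length z" using z(2) by auto
      ultimately have "x \<in> F" unfolding F_def using z by simp
      moreover have "vtx (hd z) = vtx (track x 0)" using hd[of x] x z la by simp
      ultimately show "v \<in> (\<lambda>x. vtx (track x 0)) ` F" unfolding v by simp
    qed
  qed
qed

text \<open>If every extension were dead, one residual set \<open>Z\<close> would avoid the first
  vertices of all joined walks, since there are only countably many approximations. No two first
  vertices in \<open>Z\<close> of realizations of \<open>a\<close> could then be linked by an odd
  walk, for this walk and the two realizations would make up a joined walk. So these vertices can be
  discarded too, and \<open>a\<close> itself is dead.\<close>

lemma not_dead_step:
  assumes "\<not> dead m a"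
  shows "\<exists>a'. joined_copies m a a' \<and> \<not> dead (Suc m) a'"
proof (rule ccontr)
  assume "\<not> (\<exists>a'. joined_copies m a a' \<and> \<not> dead (Suc m) a')"
  then have all_dead: "dead (Suc m) a'" if "joined_copies m a a'" for a' using that by blast
  define kills where "kills a' Y \<longleftrightarrow> residual G Y \<and>
    (\<forall>z. coded_walk z \<longrightarrow> restr (Suc m) z = a' \<longrightarrow> vtx (hd z) \<notin> Y)" for a' Y
  \<comment> \<open>The default \<open>UNIV\<close> is residual and imposes nothing, so that
    \<open>Z\<close> can be an intersection over all approximations.\<close>
  define Y where "Y a' = (if dead (Suc m) a' then SOME Y. kills a' Y else UNIV)" for a'
  have kills: "kills a' (Y a')" if "dead (Suc m) a'" for a'
  proof -
    have "\<exists>Y. kills a' Y" using that unfolding dead_def kills_def .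
    then have "kills a' (SOME Y. kills a' Y)" by (rule someI_ex)
    then show ?thesis using that by (simp add: Y_def)
  qed
  then have "residual G (Y a')" for a'
    using residual_UNIV by (cases "dead (Suc m) a'") (simp_all add: kills_def Y_def)
  define Z where "Z = (\<Inter>k. Y (from_nat k))"
  have Z: "residual G Z" unfolding Z_def by (rule residual_INT[OF sym_G]) fact
  then have Zb: "Z \<in> sets borel" and Zinv: "G `` Z \<subseteq> Z" by (auto simp: residual_def)
  have avoid: "vtx (hd z) \<notin> Z" if "coded_walk z" "joined_copies m a (restr (Suc m) z)" for z
  proof -
    have "vtx (hd z) \<notin> Y (restr (Suc m) z)" using kills[OF all_dead[OF that(2)]] that(1) by (simp add: kills_def)
    then show ?thesis unfolding Z_def by (metis INT_E UNIV_I from_nat_to_nat)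
  qed
  define A where "A = {vtx (hd z) | z. coded_walk z \<and> restr m z = a} \<inter> Z"
  have "suslin A" unfolding A_def by (rule suslin_Int_borel[OF Zb suslin_walk_start])
  moreover have "A \<subseteq> Domain G" unfolding A_def using vtx_edge(2) by blast
  moreover have "((x, False), (x', True)) \<notin> (double_cover G)\<^sup>*" if xx': "x \<in> A" "x' \<in> A" for x x'
  proof
    assume path: "((x, False), (x', True)) \<in> (double_cover G)\<^sup>*"
    obtain z0 z1 where z: "coded_walk z0" "restr m z0 = a" "vtx (hd z0) = x" "x \<in> Z"
      "coded_walk z1" "restr m z1 = a" "vtx (hd z1) = x'"
      using xx' unfolding A_def by blast
    obtain y0 t0 y1 t1 where zs: "z0 = y0 # t0" "z1 = y1 # t1"
      using coded_walk_nonempty z by (meson neq_Nil_conv)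
    obtain w y' where w: "coded_walk (w @ [y'])" "hd (w @ [y']) = y0" "vtx y' = x'" "length w mod 4 = 2"
      using coded_walk_double_cover[of y0 False x' True] path z zs by auto
    then obtain u where u: "w = y0 # u" by (cases w) auto
    have "coded_walk (rev t0 @ [y0])" using coded_walk_rev[OF z(1)] zs by simp
    then have "coded_walk (rev t0 @ y0 # u @ [y'])" by (rule coded_walk_join) (use w u in auto)
    then have "coded_walk ((rev t0 @ y0 # u) @ [y'])" by simp
    then have "coded_walk ((rev t0 @ y0 # u) @ y1 # t1)"
      by (rule coded_walk_join) (use w z zs in auto)
    then have c: "coded_walk (rev z0 @ u @ z1)" using zs by simp
    \<comment> \<open>Dropping the first vertex code \<open>y0\<close> from \<open>w\<close> turns
      the residue 2 into 1.\<close>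
    have lu: "length u mod 4 = 1" using w(4) u by (auto simp: mod_Suc split: if_splits)
    have "vtx (hd (rev z0 @ u @ z1)) \<notin> Z"
      by (rule avoid[OF c joined_copies_restr[OF lu z(2) z(6)]])
    \<comment> \<open>The first copy is reversed, so the joined walk starts at the last vertex of
      \<open>z0\<close>; invariance carries membership in \<open>Z\<close> there from the first
      vertex.\<close>
    moreover have "hd (rev z0 @ u @ z1) = last z0" using zs by (simp add: hd_append hd_rev)
    moreover have "vtx (last z0) \<in> Z"
      by (rule coded_walk_last_invariant[OF z(1) Zinv]) (simp add: z)
    ultimately show False by simp
  qed
  ultimately obtain B where B: "B \<in> sets borel" "A \<subseteq> B" "G `` B \<subseteq> B" "borel_bipartite (G \<inter> B \<times> B)"
    using odd_walk_free_borel_superset[OF suslin_G sym_G] by metis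
  have "residual G (Z - B)" by (rule residual_Diff[OF sym_G Z B(1,3,4)])
  moreover have "vtx (hd z) \<notin> Z - B" if "coded_walk z" "restr m z = a" for z
    using that B(2) unfolding A_def by blast
  ultimately have "dead m a" unfolding dead_def by blast
  then show False using assms by simp
qed

lemma alive_chain:
  assumes "\<not> borel_bipartite G"
  obtains s where "s 0 = [[], [], []]" "\<And>m. joined_copies m (s m) (s (Suc m))"
    "\<And>m. \<exists>z. coded_walk z \<and> restr m z = s m"
proof -
  have "\<exists>s. \<forall>m. (\<not> dead m (s m) \<and> (m = 0 \<longrightarrow> s m = [[], [], []])) \<and>
      joined_copies m (s m) (s (Suc m))"
  proof (rule dependent_nat_choice)
    show "\<exists>a. \<not> dead 0 a \<and> (0 = 0 \<longrightarrow> a = [[], [], []])" using not_dead_root[OF assms] by blast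
    show "\<exists>a'. (\<not> dead (Suc m) a' \<and> (Suc m = 0 \<longrightarrow> a' = [[], [], []])) \<and> joined_copies m a a'"
      if "\<not> dead m a \<and> (m = 0 \<longrightarrow> a = [[], [], []])" for a m
      using that not_dead_step[of m a] by blast
  qed
  then obtain s where "\<And>m. \<not> dead m (s m)" "s 0 = [[], [], []]"
    "\<And>m. joined_copies m (s m) (s (Suc m))" by blast
  then show thesis using that not_dead_walk by blast
qed

end

section \<open>The homomorphism from \<open>L\<^sub>0\<close>\<close>

text \<open>Move towards \<open>b\<close> and, once there, step to and fro; \<open>0 < q\<close>
  leaves room for this, and by the parity condition the surplus of steps is even.\<close>

lemma bounded_walk_exists:
  fixes a b q L :: nat
  assumes "0 < q" "a \<le> q" "b \<le> q" "a \<le> b + L" "b \<le> a + L" "even (a + b + L)"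
  shows "\<exists>g. g 0 = a \<and> g L = b \<and> (\<forall>i\<le>L. g i \<le> q) \<and> (\<forall>i<L. \<bar>int (g (Suc i)) - int (g i)\<bar> = 1)"
  using assms(2-)
proof (induction L arbitrary: a)
  case 0
  then show ?case by (intro exI[of _ "\<lambda>_. a"]) auto
next
  case (Suc L)
  obtain a' where a': "a' \<le> q" "\<bar>int a' - int a\<bar> = 1" "a' \<le> b + L" "b \<le> a' + L"
  proof -
    consider "a < b" | "b < a" | "a = b" "L \<ge> 1" using Suc.prems by (cases "a = b"; cases L) force+
    then show thesis
    proof cases
      case 1 then show thesis using that[of "a + 1"] Suc.prems by auto
    next
      case 2 then show thesis using that[of "a - 1"] Suc.prems by auto
    next
      case 3
      then show thesis using that[of "a + 1"] that[of "a - 1"] Suc.prems assms(1)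
        by (cases "a < q") auto
    qed
  qed
  have "even (a' + b + L)" using a'(2) Suc.prems(5) by presburger
  then obtain g where g: "g 0 = a'" "g L = b" "\<forall>i\<le>L. g i \<le> q"
    "\<forall>i<L. \<bar>int (g (Suc i)) - int (g i)\<bar> = 1" using Suc.IH[of a'] a' Suc.prems by blast
  have "\<bar>int (case_nat a g (Suc i)) - int (case_nat a g i)\<bar> = 1" if "i < Suc L" for i
    using that g a'(2) by (cases i) auto
  moreover have "case_nat a g i \<le> q" if "i \<le> Suc L" for i
    using that g Suc.prems(1) by (cases i) auto
  ultimately show ?case using g by (intro exI[of _ "case_nat a g"]) simp
qed

lemma c\<^sub>0_Suc: "c\<^sub>0 (Suc n) = 2 * n + 1" and c\<^sub>0_pos: "0 < c\<^sub>0 0"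
  by (simp_all add: c\<^sub>0_def)

lemma X_fin_SucE:
  assumes "v \<in> X_fin c (Suc n)"
  obtains k where "v = [k]" "k \<le> c (Suc n)"
  | w j where "v = w @ [j]" "w \<in> X_fin c n" "j < 2"
proof -
  obtain m k t where v: "m \<le> Suc n" "v = k # t" "k \<le> c m" "length t = Suc n - m" "set t \<subseteq> {0, 1}"
    using assms by (auto simp: X_fin_def)
  show thesis
  proof (cases "m = Suc n")
    case True then show thesis using v that(1) by auto
  next
    case False
    then have "t \<noteq> []" using v by auto
    then have t: "t = butlast t @ [last t]" by simp
    have "last t \<in> {0, 1}" using v(5) last_in_set[OF \<open>t \<noteq> []\<close>] by blast
    moreover have "set (butlast t) \<subseteq> {0, 1}" using v(5) in_set_butlastD[of _ t] by blast
    ultimately have "k # butlast t \<in> X_fin c n" "last t < 2"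
      using v False by (auto simp: X_fin_def intro!: bexI[of _ m])
    moreover have "v = (k # butlast t) @ [last t]" using v(2) t by simp
    ultimately show thesis using that(2) by blast
  qed
qed

lemma X_fin_nonempty: "v \<in> X_fin c n \<Longrightarrow> v \<noteq> []"
  by (auto simp: X_fin_def)

lemma pi_fin_Suc:
  "fst x \<le> n \<Longrightarrow> pi_fin (Suc n) x = pi_fin n x @ [snd (snd x) (n - fst x)]"
  by (cases x) (simp add: pi_fin_def Suc_diff_le)

lemma pi_fin_nonempty: "pi_fin n x \<noteq> []"
  by (cases x) (simp add: pi_fin_def)

text \<open>Every edge new at stage \<open>Suc n\<close> has an endpoint that is a one-element list,
  so an edge between two longer lists is copied from stage \<open>n\<close>.\<close>

lemma L_fin_same_last:
  assumes "{v @ [j], w @ [j']} \<in> L_fin c (Suc n)" "v \<noteq> []" "w \<noteq> []"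
  shows "j = j'" "{v, w} \<in> L_fin c n"
  using assms by (auto simp: path_edges_def doubleton_eq_iff insert_commute)

section \<open>The chain of target paths and the delayed passage along it\<close>

locale copy_chain =
  fixes s :: "nat \<Rightarrow> nat list list"
  assumes s_0: "s 0 = [[], [], []]" and s_joined: "joined_copies m (s m) (s (Suc m))"
    and s_restr: "\<exists>z. restr m z = s m"
begin

definition Q :: "nat \<Rightarrow> nat" where
  "Q m = length (s m) div 2"

lemma Q_0: "Q 0 = 1"
  by (simp add: Q_def s_0)

text \<open>Since \<open>length u = 4 * k + 1\<close>, the connecting walk has
  \<open>2 * k + 1\<close> edges, and \<open>Q (Suc m) = 2 * Q m + 2 * k + 1\<close> is odd again.
  The reversed copy occupies the beginning of the list, the other copy its end.\<close>

lemma s_copies: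
  shows "length (s m) = 2 * Q m + 1" and "odd (Q m)" and "2 * Q m \<le> Q (Suc m)"
    and "I \<le> 2 * Q m \<Longrightarrow> take m (s (Suc m) ! (2 * Q m - I)) = s m ! I"
    and "I \<le> 2 * Q m \<Longrightarrow> take m (s (Suc m) ! (2 * Q (Suc m) - 2 * Q m + I)) = s m ! I"
proof -
  have step: "length (s (Suc m)) = 2 * Q (Suc m) + 1 \<and> odd (Q (Suc m)) \<and> 2 * Q m \<le> Q (Suc m) \<and>
      (\<forall>I \<le> 2 * Q m. take m (s (Suc m) ! (2 * Q m - I)) = s m ! I \<and>
        take m (s (Suc m) ! (2 * Q (Suc m) - 2 * Q m + I)) = s m ! I)"
    if len: "length (s m) = 2 * Q m + 1" for m
  proof -
    obtain b0 u b1 where b: "s (Suc m) = rev b0 @ u @ b1" "length u mod 4 = 1"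
      "map (take m) b0 = s m" "map (take m) b1 = s m"
      using s_joined[of m] unfolding joined_copies_def by blast
    have l: "length b0 = 2 * Q m + 1" "length b1 = 2 * Q m + 1"
      using arg_cong[OF b(3), of length] arg_cong[OF b(4), of length] len by auto
    obtain k where k: "length u = 4 * k + 1" using b(2) by (metis mult.commute div_mult_mod_eq)
    have q: "Q (Suc m) = 2 * Q m + 2 * k + 1" unfolding Q_def[of "Suc m"] b(1) using l k by simp
    have "take m (s (Suc m) ! (2 * Q m - I)) = s m ! I" if I: "I \<le> 2 * Q m" for I
    proof -
      have "2 * Q m - I < length (rev b0)" using l by simp
      then have "s (Suc m) ! (2 * Q m - I) = b0 ! I"
        unfolding b(1) nth_append using I l by (simp add: rev_nth)
      then show ?thesis using I l b(3) by (metis Suc_eq_plus1 less_Suc_eq_le nth_map)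
    qed
    moreover have "take m (s (Suc m) ! (2 * Q (Suc m) - 2 * Q m + I)) = s m ! I" if I: "I \<le> 2 * Q m" for I
    proof -
      have "2 * Q (Suc m) - 2 * Q m + I = length (rev b0) + (length u + I)" using l k q by simp
      then have "s (Suc m) ! (2 * Q (Suc m) - 2 * Q m + I) = b1 ! I"
        unfolding b(1) by (simp only: nth_append_length_plus)
      then show ?thesis using I l b(4) by (metis Suc_eq_plus1 less_Suc_eq_le nth_map)
    qed
    moreover have "length (s (Suc m)) = 2 * Q (Suc m) + 1" using b(1) l k q by simp
    ultimately show ?thesis using q by simp
  qed
  have len: "length (s m) = 2 * Q m + 1" for m
  proof (induction m)
    case 0 then show ?case by (simp add: Q_0 s_0)
  next
    case (Suc m) then show ?case using step by blast
  qed
  show "length (s m) = 2 * Q m + 1" by (rule len)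
  show "odd (Q m)" using step[OF len] Q_0 by (cases m) auto
  show "2 * Q m \<le> Q (Suc m)" using step[OF len] by blast
  show "I \<le> 2 * Q m \<Longrightarrow> take m (s (Suc m) ! (2 * Q m - I)) = s m ! I" using step[OF len] by blast
  show "I \<le> 2 * Q m \<Longrightarrow> take m (s (Suc m) ! (2 * Q (Suc m) - 2 * Q m + I)) = s m ! I"
    using step[OF len] by blast
qed

text \<open>The target passes to the next refinement only once the new paths of \<open>L\<^sub>0\<close> have become long enough;
  \<open>\<mu> n\<close> is the refinement used for the \<open>n\<close>th finite approximation of \<open>L\<^sub>0\<close>.\<close>

primrec \<mu> :: "nat \<Rightarrow> nat" where
  "\<mu> 0 = 0"
| "\<mu> (Suc n) = (if Q (Suc (\<mu> n)) \<le> 2 * n + 3 then Suc (\<mu> n) else \<mu> n)"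

definition q :: "nat \<Rightarrow> nat" where "q n = Q (\<mu> n)"

text \<open>The number \<open>2 * n + 3\<close> in \<open>\<mu>\<close> is
  \<open>c\<^sub>0 (Suc n) + 2\<close>, the number of edges of the path that joins the two copies of
  \<open>s_seq c\<^sub>0 n\<close>. With this bound that path is long enough to cross the whole
  target of stage \<open>Suc n\<close>.\<close>

lemma q_le: "q n \<le> 2 * n + 1"
  by (induction n) (auto simp: q_def Q_0)

lemma odd_q: "odd (q n)"
  by (simp add: q_def s_copies)

lemma q_mono: "q n \<le> q (Suc n)" and q_double: "\<mu> (Suc n) \<noteq> \<mu> n \<Longrightarrow> 2 * q n \<le> q (Suc n)"
  using s_copies(3)[of "\<mu> n"] by (auto simp: q_def)

lemma \<mu>_mono: "n \<le> n' \<Longrightarrow> \<mu> n \<le> \<mu> n'"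
  by (rule lift_Suc_mono_le[of \<mu>]) auto

lemma \<mu>_unbounded: "\<exists>n. m \<le> \<mu> n"
proof (induction m)
  case (Suc m)
  then obtain n where n: "m \<le> \<mu> n" by blast
  show ?case
  proof (rule ccontr)
    assume no: "\<nexists>n. Suc m \<le> \<mu> n"
    let ?n = "n + Q (Suc m)"
    have "\<mu> ?n = m" using \<mu>_mono[of n ?n] n no by (metis le_add1 le_antisym not_less_eq_eq order_trans)
    then have "\<mu> (Suc ?n) = Suc m" by simp
    then show False using no by (metis order_refl)
  qed
qed auto

text \<open>In both cases the two copies are exchanged by the reflection of the target path, whose length is
  odd; hence corresponding vertices of the two copies are joined by odd walks.\<close>

definition \<kappa> :: "nat \<Rightarrow> nat \<Rightarrow> nat \<Rightarrow> nat" where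
  "\<kappa> n j i = (if \<mu> (Suc n) = \<mu> n then (if j = 0 then i else q n - i)
     else (if j = 0 then q n - i else q (Suc n) - q n + i))"

text \<open>The counterpart of \<open>\<kappa>\<close> for codes: vertex \<open>i\<close> is coded at position \<open>2 * i\<close>, the edge between \<open>i\<close> and
  \<open>i'\<close> at position \<open>i + i'\<close>.\<close>

definition \<kappa>\<kappa> :: "nat \<Rightarrow> nat \<Rightarrow> nat \<Rightarrow> nat" where
  "\<kappa>\<kappa> n j I = (if \<mu> (Suc n) = \<mu> n then (if j = 0 then I else 2 * q n - I)
     else (if j = 0 then 2 * q n - I else 2 * q (Suc n) - 2 * q n + I))"

lemma \<kappa>_le: "i \<le> q n \<Longrightarrow> \<kappa> n j i \<le> q (Suc n)"
  using q_mono[of n] by (auto simp: \<kappa>_def)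

lemma \<kappa>_reflect: "i \<le> q n \<Longrightarrow> j \<noteq> 0 \<Longrightarrow> \<kappa> n j i = q (Suc n) - \<kappa> n 0 i"
  using q_mono[of n] by (auto simp: \<kappa>_def q_def)

lemma \<kappa>_adjacent:
  "i \<le> q n \<Longrightarrow> i' \<le> q n \<Longrightarrow> \<bar>int i - int i'\<bar> = 1 \<Longrightarrow> \<bar>int (\<kappa> n j i) - int (\<kappa> n j i')\<bar> = 1"
  using q_mono[of n] by (auto simp: \<kappa>_def)

lemma \<kappa>\<kappa>_add: "i \<le> q n \<Longrightarrow> i' \<le> q n \<Longrightarrow> \<kappa>\<kappa> n j (i + i') = \<kappa> n j i + \<kappa> n j i'"
  using q_mono[of n] by (auto simp: \<kappa>_def \<kappa>\<kappa>_def)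

lemma \<kappa>\<kappa>_le: "I \<le> 2 * q n \<Longrightarrow> \<kappa>\<kappa> n j I \<le> 2 * q (Suc n)"
  using q_mono[of n] by (auto simp: \<kappa>\<kappa>_def)

lemma \<kappa>\<kappa>_reflect:
  "I \<le> 2 * q n \<Longrightarrow> 2 * q (Suc n) - \<kappa>\<kappa> n j I = \<kappa>\<kappa> n (if j = 0 then 1 else 0) I"
  using q_double[of n] by (auto simp: \<kappa>\<kappa>_def q_def)

lemma take_\<kappa>\<kappa>:
  assumes "\<mu> (Suc n) \<noteq> \<mu> n" "I \<le> 2 * q n"
  shows "take (\<mu> n) (s (\<mu> (Suc n)) ! \<kappa>\<kappa> n j I) = s (\<mu> n) ! I"
proof -
  have "\<mu> (Suc n) = Suc (\<mu> n)" using assms(1) by (auto split: if_splits)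
  then show ?thesis using assms(2) s_copies(4,5)[of I "\<mu> n"] by (auto simp: \<kappa>\<kappa>_def q_def)
qed

text \<open>The condition \<open>Suc k < \<mu> n\<close> puts digit \<open>k\<close> among the first
  \<open>\<mu> n - 1\<close>, those respected by reflection. The stage depends on \<open>n0\<close>
  and \<open>k\<close> alone, which will give continuity.\<close>

definition settled :: "nat \<Rightarrow> nat \<Rightarrow> nat" where
  "settled n0 k = (LEAST n. n0 \<le> n \<and> \<mu> n0 < \<mu> n \<and> Suc k < \<mu> n)"

lemma settled: "n0 \<le> settled n0 k \<and> \<mu> n0 < \<mu> (settled n0 k) \<and> Suc k < \<mu> (settled n0 k)"
  unfolding settled_def
proof (rule LeastI_ex)
  obtain n where "Suc (Suc (\<mu> n0 + k)) \<le> \<mu> n" using \<mu>_unbounded by blast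
  moreover have "\<mu> n \<le> \<mu> (max n n0)" by (rule \<mu>_mono) simp
  ultimately show "\<exists>n. n0 \<le> n \<and> \<mu> n0 < \<mu> n \<and> Suc k < \<mu> n"
    by (intro exI[of _ "max n n0"]) auto
qed

definition limit_code :: "nat \<Rightarrow> (nat \<Rightarrow> nat) \<Rightarrow> nat \<Rightarrow> nat" where
  "limit_code n0 I k = s (\<mu> (settled n0 k)) ! I (settled n0 k) ! k"

text \<open>While the target does not change, positions get reflected. Reflected positions agree only up to the
  previous refinement, and only for positions stemming from it; this is why digits settle late.\<close>

lemma limit_code:
  assumes I: "I n0 \<le> 2 * q n0" "\<And>n. n0 \<le> n \<Longrightarrow> I (Suc n) = \<kappa>\<kappa> n (j n) (I n)"
  shows "settled n0 k \<le> n \<Longrightarrow> s (\<mu> n) ! I n ! k = limit_code n0 I k"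
proof -
  have le: "I n \<le> 2 * q n" if "n0 \<le> n" for n
    using that by (induction rule: dec_induct) (auto simp: I \<kappa>\<kappa>_le)
  define sym where "sym n J \<longleftrightarrow> take (\<mu> n - 1) (s (\<mu> n) ! J) = take (\<mu> n - 1) (s (\<mu> n) ! (2 * q n - J))" for n J
  have sym: "\<mu> n0 < \<mu> n \<longrightarrow> sym n (I n)" if "n0 \<le> n" for n
    using that
  proof (induction rule: dec_induct)
    case (step n)
    show ?case
    proof (cases "\<mu> (Suc n) = \<mu> n")
      case True
      then have "q (Suc n) = q n" by (simp add: q_def)
      then show ?thesis using step True le[OF step(1)]
        by (auto simp: I(2)[OF step(1)] \<kappa>\<kappa>_def sym_def simp del: \<mu>.simps)
    next
      \<comment> \<open>When the target changes, the new position and its reflection are the two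
        copies of one old position and hence share its digits.\<close>
      case False
      then have "\<mu> (Suc n) - 1 = \<mu> n" by (auto split: if_splits)
      then show ?thesis
        using take_\<kappa>\<kappa>[OF False le[OF step(1)]] \<kappa>\<kappa>_reflect[OF le[OF step(1)]]
        by (simp add: I(2)[OF step(1)] sym_def del: \<mu>.simps)
    qed
  qed auto
  have stay: "s (\<mu> (Suc n)) ! I (Suc n) ! k = s (\<mu> n) ! I n ! k"
    if n: "n0 \<le> n" "\<mu> n0 < \<mu> n" "Suc k < \<mu> n" for n
  proof (cases "\<mu> (Suc n) = \<mu> n")
    case True
    have "take (\<mu> n - 1) (s (\<mu> n) ! I (Suc n)) = take (\<mu> n - 1) (s (\<mu> n) ! I n)"
      using sym[OF n(1)] n(2) True by (auto simp: I(2)[OF n(1)] \<kappa>\<kappa>_def sym_def simp del: \<mu>.simps)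
    then have "take (\<mu> n - 1) (s (\<mu> n) ! I (Suc n)) ! k = take (\<mu> n - 1) (s (\<mu> n) ! I n) ! k" by simp
    then show ?thesis unfolding True using n(3) by simp
  next
    case False
    have "take (\<mu> n) (s (\<mu> (Suc n)) ! I (Suc n)) ! k = s (\<mu> n) ! I n ! k"
      using take_\<kappa>\<kappa>[OF False le[OF n(1)]] by (simp add: I(2)[OF n(1)] del: \<mu>.simps)
    then show ?thesis using n(3) by (simp del: \<mu>.simps)
  qed
  show "settled n0 k \<le> n \<Longrightarrow> s (\<mu> n) ! I n ! k = limit_code n0 I k"
  proof (induction rule: dec_induct)
    case base then show ?case by (simp add: limit_code_def)
  next
    case (step n)
    have "\<mu> (settled n0 k) \<le> \<mu> n" by (rule \<mu>_mono) (use step in simp)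
    then show ?case using settled[of n0 k] step stay[of n] by (simp del: \<mu>.simps)
  qed
qed

definition route :: "nat \<Rightarrow> nat \<Rightarrow> nat \<Rightarrow> nat" where
  "route n a = (SOME g. g 0 = a \<and> g (2 * n + 3) = q (Suc n) - a \<and> (\<forall>i\<le>2 * n + 3. g i \<le> q (Suc n)) \<and>
     (\<forall>i<2 * n + 3. \<bar>int (g (Suc i)) - int (g i)\<bar> = 1))"

text \<open>Since \<open>q (Suc n)\<close> is odd, \<open>a\<close> and its mirror image have odd
  distance. This distance is at most \<open>q (Suc n) \<le> 2 * n + 3\<close>, and
  \<open>2 * n + 3\<close> is odd as well, so a walk with exactly this number of steps
  exists.\<close>

lemma route:
  assumes "a \<le> q (Suc n)"
  shows "route n a 0 = a" "route n a (2 * n + 3) = q (Suc n) - a"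
    "i \<le> 2 * n + 3 \<Longrightarrow> route n a i \<le> q (Suc n)"
    "i < 2 * n + 3 \<Longrightarrow> \<bar>int (route n a (Suc i)) - int (route n a i)\<bar> = 1"
proof -
  have "q (Suc n) \<le> 2 * n + 3" using q_le[of "Suc n"] by simp
  moreover have "odd (q (Suc n))" by (rule odd_q)
  moreover have "0 < q (Suc n)" using odd_q[of "Suc n"] by (cases "q (Suc n) = 0") auto
  moreover have "even (a + (q (Suc n) - a) + (2 * n + 3))" using assms odd_q[of "Suc n"] by simp
  ultimately have "\<exists>g. g 0 = a \<and> g (2 * n + 3) = q (Suc n) - a \<and> (\<forall>i\<le>2 * n + 3. g i \<le> q (Suc n)) \<and>
     (\<forall>i<2 * n + 3. \<bar>int (g (Suc i)) - int (g i)\<bar> = 1)"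
    using assms by (intro bounded_walk_exists) auto
  from someI_ex[OF this] show "route n a 0 = a" "route n a (2 * n + 3) = q (Suc n) - a"
    "i \<le> 2 * n + 3 \<Longrightarrow> route n a i \<le> q (Suc n)"
    "i < 2 * n + 3 \<Longrightarrow> \<bar>int (route n a (Suc i)) - int (route n a i)\<bar> = 1"
    unfolding route_def by blast+
qed

text \<open>The map from the \<open>n\<close>th finite graph to the target path of length
  \<open>q n\<close>. The new vertex \<open>[k]\<close> gets index \<open>Suc k\<close> on the
  route, because index 0 belongs to the first copy of \<open>s_seq c\<^sub>0 n\<close> and index
  \<open>2 * n + 3\<close> to the second.\<close>

primrec pos :: "nat \<Rightarrow> nat list \<Rightarrow> nat" where
  "pos 0 v = hd v"
| "pos (Suc n) v = (if length v = 1 then route n (\<kappa> n 0 (pos n (s_seq c\<^sub>0 n))) (Suc (hd v))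
     else \<kappa> n (last v) (pos n (butlast v)))"

lemma pos_snoc: "v \<noteq> [] \<Longrightarrow> pos (Suc n) (v @ [j]) = \<kappa> n j (pos n v)"
  by simp

lemma pos_le: "v \<in> X_fin c\<^sub>0 n \<Longrightarrow> pos n v \<le> q n"
proof (induction n arbitrary: v)
  case 0
  then show ?case by (auto simp: X_fin_def c\<^sub>0_def q_def Q_0)
next
  case (Suc n)
  from Suc.prems show ?case
  proof (cases rule: X_fin_SucE)
    case (1 k)
    have "\<kappa> n 0 (pos n (s_seq c\<^sub>0 n)) \<le> q (Suc n)"
      by (intro \<kappa>_le Suc.IH s_seq_in_X_fin c\<^sub>0_pos)
    from route(3)[OF this, of "Suc k"] show ?thesis using 1 by (simp add: c\<^sub>0_Suc)
  next
    case (2 w j)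
    then show ?thesis using \<kappa>_le[OF Suc.IH[OF 2(2)]] pos_snoc[OF X_fin_nonempty[OF 2(2)]] by simp
  qed
qed

lemma pos_adjacent: "{v, w} \<in> L_fin c\<^sub>0 n \<Longrightarrow> \<bar>int (pos n v) - int (pos n w)\<bar> = 1"
proof (induction n arbitrary: v w)
  case 0
  then show ?case by (auto simp: path_edges_def doubleton_eq_iff)
next
  case (Suc n)
  let ?s = "s_seq c\<^sub>0 n" and ?a = "\<kappa> n 0 (pos n (s_seq c\<^sub>0 n))"
  have s: "?s \<in> X_fin c\<^sub>0 n" by (intro s_seq_in_X_fin c\<^sub>0_pos)
  have a: "?a \<le> q (Suc n)" by (intro \<kappa>_le pos_le s)
  have single: "pos (Suc n) [k] = route n ?a (Suc k)" for k by simp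
  have s0: "pos (Suc n) (?s @ [0]) = route n ?a 0"
    using pos_snoc[OF X_fin_nonempty[OF s]] route(1)[OF a] by simp
  \<comment> \<open>The far end of the route fits because the second copy of a vertex always lies at
    the mirror image of the first.\<close>
  have s1: "pos (Suc n) (?s @ [1]) = route n ?a (2 * n + 3)"
    using pos_snoc[OF X_fin_nonempty[OF s]] route(2)[OF a] \<kappa>_reflect[OF pos_le[OF s], of 1] by simp
  have main: "\<exists>v w. e = {v, w} \<and> \<bar>int (pos (Suc n) v) - int (pos (Suc n) w)\<bar> = 1"
    if e: "e \<in> L_fin c\<^sub>0 (Suc n)" for e
  proof -
    consider v0 v1 j where "e = {v0 @ [j], v1 @ [j]}" "j < 2" "{v0, v1} \<in> L_fin c\<^sub>0 n"
      | "e \<in> path_edges (c\<^sub>0 (Suc n))"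
      | "e = {?s @ [0], [0]}" | "e = {[c\<^sub>0 (Suc n)], ?s @ [1]}"
      using e by auto
    then show ?thesis
    proof cases
      case 1
      then have v: "v0 \<in> X_fin c\<^sub>0 n" "v1 \<in> X_fin c\<^sub>0 n" using L_fin_is_graph[where c = c\<^sub>0, OF c\<^sub>0_pos 1(3)] by auto
      have "\<bar>int (pos (Suc n) (v0 @ [j])) - int (pos (Suc n) (v1 @ [j]))\<bar> = 1"
        unfolding pos_snoc[OF X_fin_nonempty[OF v(1)]] pos_snoc[OF X_fin_nonempty[OF v(2)]]
        by (intro \<kappa>_adjacent pos_le v Suc.IH 1(3))
      then show ?thesis using 1(1) by blast
    next
      case 2
      then obtain i j where ij: "e = {[i], [j]}" "i \<le> 2 * n + 1" "j \<le> 2 * n + 1" "\<bar>int i - int j\<bar> = 1"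
        by (auto simp: path_edges_def c\<^sub>0_Suc)
      then have "j = Suc i \<or> i = Suc j" by auto
      then have "\<bar>int (pos (Suc n) [i]) - int (pos (Suc n) [j])\<bar> = 1"
        unfolding single using route(4)[OF a, of "Suc i"] route(4)[OF a, of "Suc j"] ij by auto
      then show ?thesis using ij(1) by blast
    next
      case 3
      have "\<bar>int (pos (Suc n) (?s @ [0])) - int (pos (Suc n) [0])\<bar> = 1"
        unfolding single s0 using route(4)[OF a, of 0] by (simp add: abs_minus_commute)
      then show ?thesis using 3 by blast
    next
      case 4
      have "\<bar>int (pos (Suc n) [c\<^sub>0 (Suc n)]) - int (pos (Suc n) (?s @ [1]))\<bar> = 1"
        unfolding single s1 c\<^sub>0_Suc using route(4)[OF a, of "2 * n + 2"]
        by (simp add: abs_minus_commute numeral_3_eq_3)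
      then show ?thesis using 4 by blast
    qed
  qed
  from main[OF Suc.prems] show ?case
    by (auto simp: doubleton_eq_iff abs_minus_commute simp del: pos.simps)
qed

lemma pos_pi_le: "x \<in> X\<^sub>0 \<Longrightarrow> fst x \<le> n \<Longrightarrow> pos n (pi_fin n x) \<le> q n"
  unfolding X\<^sub>0_def by (intro pos_le pi_in_X_fin)

lemma pos_pi_Suc:
  "fst x \<le> n \<Longrightarrow> pos (Suc n) (pi_fin (Suc n) x) = \<kappa> n (snd (snd x) (n - fst x)) (pos n (pi_fin n x))"
  by (simp only: pi_fin_Suc pos_snoc[OF pi_fin_nonempty])

definition vertex_code :: "nat \<times> nat \<times> (nat \<Rightarrow> nat) \<Rightarrow> nat \<Rightarrow> nat" where
  "vertex_code x = limit_code (fst x) (\<lambda>n. 2 * pos n (pi_fin n x))"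

text \<open>The sum of two neighbouring positions is the list index of the edge between them. It
  starts at the maximum, where both projections are meaningful.\<close>

definition edge_code where
  "edge_code x x' = limit_code (max (fst x) (fst x')) (\<lambda>n. pos n (pi_fin n x) + pos n (pi_fin n x'))"

lemma vertex_code:
  assumes "x \<in> X\<^sub>0" "settled (fst x) k \<le> n"
  shows "s (\<mu> n) ! (2 * pos n (pi_fin n x)) ! k = vertex_code x k"
  unfolding vertex_code_def
proof (rule limit_code[OF _ _ assms(2)])
  show "2 * pos (fst x) (pi_fin (fst x) x) \<le> 2 * q (fst x)" using pos_pi_le[OF assms(1)] by simp
  show "2 * pos (Suc n) (pi_fin (Suc n) x) = \<kappa>\<kappa> n (snd (snd x) (n - fst x)) (2 * pos n (pi_fin n x))"
    if "fst x \<le> n" for n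
    using \<kappa>\<kappa>_add[OF pos_pi_le[OF assms(1) that] pos_pi_le[OF assms(1) that]]
    unfolding pos_pi_Suc[OF that] mult_2 by simp
qed

text \<open>Adjacent points of \<open>L\<^sub>0\<close> receive the same bit at each later stage, so
  the same \<open>\<kappa>\<close> moves both positions and \<open>\<kappa>\<kappa>\<close> moves
  their sum.\<close>

lemma edge_code:
  assumes e: "(x, x') \<in> L\<^sub>0" and n: "settled (max (fst x) (fst x')) k \<le> n"
  shows "s (\<mu> n) ! (pos n (pi_fin n x) + pos n (pi_fin n x')) ! k = edge_code x x' k"
  unfolding edge_code_def
proof (rule limit_code[OF _ _ n])
  have X: "x \<in> X\<^sub>0" "x' \<in> X\<^sub>0" and L: "\<And>n. max (fst x) (fst x') \<le> n \<Longrightarrow> {pi_fin n x, pi_fin n x'} \<in> L_fin c\<^sub>0 n"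
    using e by (auto simp: L\<^sub>0_def L_lim_def X\<^sub>0_def)
  show "pos (max (fst x) (fst x')) (pi_fin (max (fst x) (fst x')) x) +
      pos (max (fst x) (fst x')) (pi_fin (max (fst x) (fst x')) x') \<le> 2 * q (max (fst x) (fst x'))"
    using pos_pi_le[OF X(1), of "max (fst x) (fst x')"] pos_pi_le[OF X(2), of "max (fst x) (fst x')"] by simp
  fix n assume n: "max (fst x) (fst x') \<le> n"
  then have le: "fst x \<le> n" "fst x' \<le> n" by auto
  have "max (fst x) (fst x') \<le> Suc n" using n by simp
  from L_fin_same_last(1)[OF L[OF this, unfolded pi_fin_Suc[OF le(1)] pi_fin_Suc[OF le(2)]] pi_fin_nonempty pi_fin_nonempty]
  have same: "snd (snd x') (n - fst x') = snd (snd x) (n - fst x)" by simp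
  show "pos (Suc n) (pi_fin (Suc n) x) + pos (Suc n) (pi_fin (Suc n) x') =
      \<kappa>\<kappa> n (snd (snd x) (n - fst x)) (pos n (pi_fin n x) + pos n (pi_fin n x'))"
    unfolding pos_pi_Suc[OF le(1)] pos_pi_Suc[OF le(2)] same
    by (intro \<kappa>\<kappa>_add[symmetric] pos_pi_le X le)
qed

text \<open>Digit \<open>k\<close> is read off at stage \<open>settled m k\<close>, where the
  projection of \<open>(m, i, r)\<close> involves only finitely many values of
  \<open>r\<close>.\<close>

lemma continuous_on_vertex_code: "continuous_on X\<^sub>0 vertex_code"
proof (rule continuous_on_coordinatewise_then_product)
  fix k
  show "continuous_on X\<^sub>0 (\<lambda>x. vertex_code x k)"
    unfolding continuous_on_topological
  proof (intro ballI allI impI)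
    fix x B assume x: "x \<in> X\<^sub>0" "vertex_code x k \<in> B"
    obtain m i r where xr: "x = (m, i, r)" by (cases x)
    define U where "U = {m} \<times> {i} \<times> cyl (map r [0..<settled m k - m])"
    have "open U" unfolding U_def
      by (intro open_Times open_cyl discrete_topology_class.open_discrete)
    moreover have "x \<in> U" by (simp add: U_def xr cyl_map)
    moreover have "vertex_code y k \<in> B" if "y \<in> U" for y
    proof -
      obtain r' where y: "y = (m, i, r')" "r' \<in> cyl (map r [0..<settled m k - m])"
        using \<open>y \<in> U\<close> unfolding U_def by auto
      then have "pi_fin (settled m k) y = pi_fin (settled m k) x"
        by (auto simp: xr pi_fin_def cyl_map)
      then have "vertex_code y k = vertex_code x k" by (simp add: vertex_code_def limit_code_def xr y(1))
      then show ?thesis using x(2) by simp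
    qed
    ultimately show "\<exists>U. open U \<and> x \<in> U \<and> (\<forall>y\<in>X\<^sub>0. y \<in> U \<longrightarrow> vertex_code y k \<in> B)"
      by (intro exI[of _ U]) blast
  qed
qed

end

section \<open>Passing to the limit\<close>

context coded_graph
begin

text \<open>Adjacency of codes, unlike \<open>G\<close> itself, is a closed condition, so it passes
  from triples that agree to ever more digits to the limit triple.\<close>

lemma adj_limit:
  assumes "\<And>K. \<exists>a e a'. adj a e a' \<and> (\<forall>k<K. a k = A k \<and> e k = E k \<and> a' k = A' k)"
  shows "adj A E A'"
proof (rule ccontr)
  assume no: "\<not> adj A E A'"
  define S where "S = {x. adj (track x 0) (track x 1) (track x 2)}"
  have "closed S" unfolding adj_def S_def
    by (intro closed_Collect_disj closed_Collect_eq continuous_on_Pair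
        continuous_on_compose2[OF continuous_\<theta> continuous_on_track]
        continuous_on_compose2[OF continuous_on_vtx continuous_on_track]) auto
  define tri where "tri a e a' n = (if n = 0 then a else if n = 1 then e else a')" for a e a' :: "nat \<Rightarrow> nat" and n :: nat
  obtain X where X: "\<And>n. track X n = tri A E A' n" using track_surj[of "tri A E A'"] by blast
  have "X \<in> - S" using no by (simp add: S_def X tri_def)
  then obtain n where n: "cyl (map X [0..<n]) \<subseteq> - S"
    using cyl_basis[of "- S" X] \<open>closed S\<close> by blast
  obtain a e a' where a: "adj a e a'" "\<And>k. k < n \<Longrightarrow> a k = A k \<and> e k = E k \<and> a' k = A' k"
    using assms[of n] by blast
  obtain x where x: "\<And>n. track x n = tri a e a' n" using track_surj[of "tri a e a'"] by blast
  have "x c = X c" if "c < n" for c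
  proof -
    obtain i k where c: "c = prod_encode (i, k)" by (metis prod_decode_inverse surj_pair)
    \<comment> \<open>The pairing function dominates its second argument, so agreement of each
      component on \<open>n\<close> digits gives agreement of the merged codes on \<open>n\<close>
      digits.\<close>
    have "k < n" using le_prod_encode_2[of k i] that c by simp
    then have "tri a e a' i k = tri A E A' i k" using a(2) by (simp add: tri_def)
    then have "track x i k = track X i k" by (simp add: x X)
    then show ?thesis by (simp add: track_def c)
  qed
  then have "x \<in> - S" using n by (auto simp: cyl_map)
  then show False using a(1) by (simp add: S_def x tri_def)
qed

text \<open>The walks realizing different stages need have nothing in common but their prescribed
  digits. For each \<open>K\<close>, one walk at a late stage contains an edge whose three codes
  agree with the limit codes on \<open>K\<close> digits.\<close>

lemma L\<^sub>0_homomorphism_exists: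
  assumes "\<not> borel_bipartite G"
  shows "\<exists>\<phi>. continuous_on X\<^sub>0 \<phi> \<and> graph_hom X\<^sub>0 L\<^sub>0 UNIV G \<phi>"
proof -
  obtain s where s: "s 0 = [[], [], []]" "\<And>m. joined_copies m (s m) (s (Suc m))"
    "\<And>m. \<exists>z. coded_walk z \<and> restr m z = s m"
    using alive_chain[OF assms] by blast
  interpret copy_chain s using s by unfold_locales blast+
  have "adj (vertex_code x) (edge_code x x') (vertex_code x')" if e: "(x, x') \<in> L\<^sub>0" for x x'
  proof (rule adj_limit)
    fix K
    have X: "x \<in> X\<^sub>0" "x' \<in> X\<^sub>0" and L: "\<And>n. max (fst x) (fst x') \<le> n \<Longrightarrow> {pi_fin n x, pi_fin n x'} \<in> L_fin c\<^sub>0 n"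
      using e by (auto simp: L\<^sub>0_def L_lim_def X\<^sub>0_def)
    let ?N = "max (fst x) (fst x')"
    \<comment> \<open>A stage at which all the digits below \<open>K\<close> have settled;
      \<open>settled ?N K\<close> is included to ensure \<open>K < \<mu> n\<close>, so that the
      approximation records these digits.\<close>
    define n where "n = Max ({?N, settled ?N K} \<union> (\<Union>k<K. {settled (fst x) k, settled (fst x') k, settled ?N k}))"
    have fin: "finite ({?N, settled ?N K} \<union> (\<Union>k<K. {settled (fst x) k, settled (fst x') k, settled ?N k}))" by simp
    have nN: "?N \<le> n" "settled ?N K \<le> n" unfolding n_def by (rule Max_ge[OF fin]; simp)+
    have nk: "settled (fst x) k \<le> n" "settled (fst x') k \<le> n" "settled ?N k \<le> n" if "k < K" for k
      unfolding n_def by (rule Max_ge[OF fin]; use that in auto)+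
    have K: "K < \<mu> n" using settled[of ?N K] \<mu>_mono[OF nN(2)] by linarith
    obtain z where z: "coded_walk z" "restr (\<mu> n) z = s (\<mu> n)" using s(3) by blast
    have lz: "length z = 2 * q n + 1"
      using arg_cong[OF z(2), of length] s_copies(1)[of "\<mu> n"] by (simp add: q_def)
    let ?i = "pos n (pi_fin n x)" and ?i' = "pos n (pi_fin n x')"
    have i: "?i \<le> q n" "?i' \<le> q n" using pos_pi_le X nN(1) by auto
    have "\<bar>int ?i - int ?i'\<bar> = 1" using pos_adjacent[OF L[OF nN(1)]] .
    then have "?i' = Suc ?i \<or> ?i = Suc ?i'" by auto
    then have a: "adj (z ! (2 * ?i)) (z ! (?i + ?i')) (z ! (2 * ?i'))"
    proof
      assume *: "?i' = Suc ?i"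
      then have "adj (z ! (2 * ?i)) (z ! (2 * ?i + 1)) (z ! (2 * ?i + 2))"
        using z(1) i(2) lz unfolding coded_walk_def by simp
      moreover have "?i + ?i' = 2 * ?i + 1" "2 * ?i' = 2 * ?i + 2" using * by auto
      ultimately show ?thesis by (simp only:)
    next
      assume *: "?i = Suc ?i'"
      then have "adj (z ! (2 * ?i')) (z ! (2 * ?i' + 1)) (z ! (2 * ?i' + 2))"
        using z(1) i(1) lz unfolding coded_walk_def by simp
      moreover have "?i + ?i' = 2 * ?i' + 1" "2 * ?i = 2 * ?i' + 2" using * by auto
      ultimately show ?thesis by (simp only: adj_sym)
    qed
    have zk: "(z ! I) k = s (\<mu> n) ! I ! k" if "I \<le> 2 * q n" "k < K" for I k
    proof -
      have "s (\<mu> n) ! I = map (z ! I) [0..<\<mu> n]"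
        unfolding z(2)[symmetric] restr_def using that(1) lz by simp
      then show ?thesis using that(2) K by simp
    qed
    show "\<exists>a e a'. adj a e a' \<and> (\<forall>k<K. a k = vertex_code x k \<and> e k = edge_code x x' k \<and> a' k = vertex_code x' k)"
    proof (intro exI conjI allI impI)
      show "adj (z ! (2 * ?i)) (z ! (?i + ?i')) (z ! (2 * ?i'))" by (rule a)
      fix k assume k: "k < K"
      show "(z ! (2 * ?i)) k = vertex_code x k"
        using zk[OF _ k, of "2 * ?i"] i vertex_code[OF X(1) nk(1)[OF k]] by simp
      show "(z ! (2 * ?i')) k = vertex_code x' k"
        using zk[OF _ k, of "2 * ?i'"] i vertex_code[OF X(2) nk(2)[OF k]] by simp
      show "(z ! (?i + ?i')) k = edge_code x x' k"
        using zk[OF _ k, of "?i + ?i'"] i edge_code[OF e nk(3)[OF k]] by simp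
    qed
  qed
  then have "(vtx (vertex_code x), vtx (vertex_code x')) \<in> G" if "(x, x') \<in> L\<^sub>0" for x x'
    using that unfolding adj_def by (metis vtx_edge(1) symD[OF sym_G])
  then have "graph_hom X\<^sub>0 L\<^sub>0 UNIV G (\<lambda>x. vtx (vertex_code x))"
    by (simp add: graph_hom_def)
  moreover have "continuous_on X\<^sub>0 (\<lambda>x. vtx (vertex_code x))"
    by (rule continuous_on_compose2[OF continuous_on_vtx continuous_on_vertex_code]) auto
  ultimately show ?thesis by blast
qed

end

section \<open>\<open>L\<^sub>0\<close> has no Borel 2-colouring\<close>

text \<open>Second countability identifies the Borel sets of the countable power of
  \<open>bool\<close> with its product sigma-algebra.\<close>

instance bool :: second_countable_topology
proof
  show "\<exists>B :: bool set set. countable B \<and> open = generate_topology B"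
    by (intro exI[of _ UNIV])
      (auto simp: fun_eq_iff intro: generate_topology.Basis discrete_topology_class.open_discrete)
qed

section \<open>Fair coin tossing and the flip of a bit\<close>

abbreviation coin :: "bool measure" where
  "coin \<equiv> measure_pmf (pmf_of_set UNIV)"

lemma emeasure_coin_Not: "emeasure coin (Not -` A) = emeasure coin A"
proof -
  have "map_pmf Not (pmf_of_set UNIV) = pmf_of_set UNIV"
    by (intro map_pmf_of_set_bij_betw) (auto simp: bij_betw_def inj_on_def)
  then show ?thesis by (metis emeasure_map_pmf)
qed

abbreviation flip :: "nat \<Rightarrow> (nat \<Rightarrow> bool) \<Rightarrow> nat \<Rightarrow> bool" where
  "flip n x \<equiv> x(n := \<not> x n)"

lemma measurable_flip: "flip n \<in> measurable (PiM UNIV (\<lambda>_. coin)) (PiM UNIV (\<lambda>_. coin))"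
  by (rule measurable_PiM_single') (auto simp: fun_upd_def)

lemma distr_flip: "distr (PiM UNIV (\<lambda>_. coin)) (PiM UNIV (\<lambda>_. coin)) (flip n) = PiM UNIV (\<lambda>_. coin)"
proof -
  let ?M = "PiM UNIV (\<lambda>_::nat. coin)"
  interpret product_prob_space "\<lambda>_::nat. coin" UNIV by unfold_locales
  show ?thesis
  proof (rule PiM_eq)
    fix J :: "nat set" and F :: "nat \<Rightarrow> bool set"
    assume J: "finite J"
    define F' where "F' = F(n := Not -` F n)"
    have S: "prod_emb UNIV (\<lambda>_. coin) J (Pi\<^sub>E J K) \<in> sets ?M" for K
      by (rule sets_PiM_I) (use J in auto)
    have "flip n -` prod_emb UNIV (\<lambda>_. coin) J (Pi\<^sub>E J F) \<inter> space ?M = prod_emb UNIV (\<lambda>_. coin) J (Pi\<^sub>E J F')"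
      unfolding prod_emb_def F'_def by (auto simp: space_PiM PiE_iff restrict_def extensional_def split: if_splits)
    then have "emeasure (distr ?M ?M (flip n)) (prod_emb UNIV (\<lambda>_. coin) J (Pi\<^sub>E J F)) =
        emeasure ?M (prod_emb UNIV (\<lambda>_. coin) J (Pi\<^sub>E J F'))"
      by (simp add: emeasure_distr[OF measurable_flip S])
    also have "\<dots> = (\<Prod>j\<in>J. emeasure coin (F' j))" by (rule emeasure_PiM_emb) (use J in auto)
    also have "\<dots> = (\<Prod>j\<in>J. emeasure coin (F j))"
      by (intro prod.cong refl) (simp add: F'_def emeasure_coin_Not)
    finally show "emeasure (distr ?M ?M (flip n)) (prod_emb UNIV (\<lambda>_. coin) J (Pi\<^sub>E J F)) =
        (\<Prod>j\<in>J. emeasure coin (F j))" .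
  qed simp
qed

text \<open>Such a set would be independent of every cylinder, hence of itself.\<close>

lemma no_measurable_flip_alternating:
  assumes A: "A \<in> sets (PiM UNIV (\<lambda>_::nat. coin))" and flip: "\<And>n x. flip n x \<in> A \<longleftrightarrow> x \<notin> A"
  shows False
proof -
  let ?M = "PiM UNIV (\<lambda>_::nat. coin)"
  interpret product_prob_space "\<lambda>_::nat. coin" UNIV by unfold_locales
  have sp: "space ?M = UNIV" by (simp add: space_PiM)
  have A': "- A \<in> sets ?M" using sets.compl_sets[OF A] by (simp add: sp Compl_eq_Diff_UNIV)
  have "density ?M (indicator A) = density ?M (indicator (- A))"
  proof (rule measure_eqI_PiM_infinite)
    fix F :: "nat \<Rightarrow> bool set" and J :: "nat set" assume J: "finite J"
    let ?E = "prod_emb UNIV (\<lambda>_. coin) J (Pi\<^sub>E J F)"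
    have E: "?E \<in> sets ?M" by (rule sets_PiM_I) (use J in auto)
    \<comment> \<open>Flipping a coordinate outside \<open>J\<close> fixes the cylinder, preserves
      the measure and exchanges \<open>A\<close> with its complement.\<close>
    obtain n where n: "n \<notin> J" using J ex_new_if_finite infinite_UNIV_nat by blast
    have "flip n x \<in> ?E \<longleftrightarrow> x \<in> ?E" for x
    proof -
      have "restrict (flip n x) J = restrict x J" using n by (auto simp: restrict_def)
      then show ?thesis by (simp add: prod_emb_def)
    qed
    then have "flip n -` (A \<inter> ?E) \<inter> space ?M = - A \<inter> ?E" using flip by (auto simp: sp)
    then have "emeasure (distr ?M ?M (flip n)) (A \<inter> ?E) = emeasure ?M (- A \<inter> ?E)"
      using emeasure_distr[OF measurable_flip, of "A \<inter> ?E"] A E by auto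
    then have "emeasure ?M (A \<inter> ?E) = emeasure ?M (- A \<inter> ?E)" by (simp only: distr_flip)
    then show "emeasure (density ?M (indicator A)) ?E = emeasure (density ?M (indicator (- A))) ?E"
      using A A' E by (simp add: emeasure_restricted)
  next
    show "finite_measure (density ?M (indicator A))"
    proof (rule finite_measureI)
      have "emeasure (density ?M (indicator A)) UNIV = emeasure ?M A"
        using emeasure_restricted[OF A, of UNIV] sets.top[of ?M] by (simp add: sp)
      then show "emeasure (density ?M (indicator A)) (space (density ?M (indicator A))) \<noteq> \<infinity>"
        by (simp add: sp)
    qed
  qed simp_all
  then have eq: "emeasure ?M (A \<inter> S) = emeasure ?M (- A \<inter> S)" if "S \<in> sets ?M" for S
    using that A A' by (metis emeasure_restricted)
  have "emeasure ?M A = 0" using eq[OF A] by simp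
  moreover have "emeasure ?M (- A) = 0" using eq[OF A'] by simp
  ultimately have "emeasure ?M (A \<union> - A) = 0"
    using A A' by (metis emeasure_Un_null_set null_setsI)
  then show False using P.emeasure_space_1 by (simp add: sp)
qed

text \<open>The point that projects to \<open>v\<close> at level \<open>n\<close> and continues with
  the bits \<open>r\<close>. A vertex born at level \<open>m\<close> has length
  \<open>n - m + 1\<close> at level \<open>n\<close>, so \<open>Suc n - length v\<close> recovers
  \<open>m\<close>.\<close>

definition tail_point :: "nat \<Rightarrow> nat list \<Rightarrow> (nat \<Rightarrow> nat) \<Rightarrow> nat \<times> nat \<times> (nat \<Rightarrow> nat)" where
  "tail_point n v r = (Suc n - length v, hd v,
     \<lambda>i. if Suc i < length v then v ! Suc i else r (Suc i - length v))"

lemma tail_point_in_X\<^sub>0: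
  assumes "v \<in> X_fin c\<^sub>0 n" "range r \<subseteq> {0, 1}"
  shows "tail_point n v r \<in> X\<^sub>0"
proof -
  obtain m k t where v: "m \<le> n" "v = k # t" "k \<le> c\<^sub>0 m" "length t = n - m" "set t \<subseteq> {0, 1}"
    using assms(1) by (auto simp: X_fin_def)
  have "(if i < length t then t ! i else r (i - length t)) \<in> {0, 1}" for i
  proof (cases "i < length t")
    case True then show ?thesis using v(5) nth_mem[OF True] by (simp only: if_True) blast
  next
    case False then show ?thesis using assms(2) by (simp only: if_False) blast
  qed
  then have "range (\<lambda>i. if i < length t then t ! i else r (i - length t)) \<subseteq> {0, 1}"
    by (rule image_subsetI)
  then show ?thesis using v(1-4) by (simp add: tail_point_def X\<^sub>0_def X_lim_def)
qed

lemma pi_fin_tail_point: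
  assumes "v \<in> X_fin c n"
  shows "pi_fin (n + i) (tail_point n v r) = v @ map r [0..<i]"
proof -
  obtain m k t where v: "m \<le> n" "v = k # t" "length t = n - m"
    using assms by (auto simp: X_fin_def)
  show ?thesis
    unfolding tail_point_def pi_fin_def v(2) using v(1,3)
    by (auto intro!: nth_equalityI simp: nth_append nth_Cons')
qed

lemma tail_point_snoc: "v \<noteq> [] \<Longrightarrow> tail_point (Suc n) (v @ [j]) r = tail_point n v (case_nat j r)"
  by (cases v) (auto simp: tail_point_def nth_append fun_eq_iff diff_Suc split: nat.split)

lemma L_fin_snoc: "{v, w} \<in> L_fin c n \<Longrightarrow> j < 2 \<Longrightarrow> {v @ [j], w @ [j]} \<in> L_fin c (Suc n)"
  by auto

text \<open>Above level \<open>n\<close> the edge persists because edges are copied with a common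
  bit. Below \<open>n\<close>, down to the level where both endpoints exist, it is present because
  an edge between two extended vertices must be a copy.\<close>

lemma tail_point_edge:
  assumes e: "{v, w} \<in> L_fin c\<^sub>0 n" and r: "range r \<subseteq> {0, 1}"
  shows "(tail_point n v r, tail_point n w r) \<in> L\<^sub>0"
proof -
  have X: "v \<in> X_fin c\<^sub>0 n" "w \<in> X_fin c\<^sub>0 n"
    using L_fin_is_graph[where c = c\<^sub>0, OF _ e] by (auto simp: c\<^sub>0_def)
  let ?x = "tail_point n v r" and ?y = "tail_point n w r"
  have up: "{pi_fin (n + i) ?x, pi_fin (n + i) ?y} \<in> L_fin c\<^sub>0 (n + i)" for i
  proof (induction i)
    case 0
    then show ?case using e pi_fin_tail_point[OF X(1), of 0] pi_fin_tail_point[OF X(2), of 0] by simp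
  next
    case (Suc i)
    have "r i \<in> {0, 1}" using r by blast
    then have "r i < 2" by auto
    from L_fin_snoc[OF Suc[unfolded pi_fin_tail_point[OF X(1)] pi_fin_tail_point[OF X(2)]] this]
    show ?case unfolding pi_fin_tail_point[OF X(1)] pi_fin_tail_point[OF X(2)] by simp
  qed
  have "{pi_fin N ?x, pi_fin N ?y} \<in> L_fin c\<^sub>0 N" if N: "max (fst ?x) (fst ?y) \<le> N" for N
  proof (cases "n \<le> N")
    case True
    then show ?thesis using up[of "N - n"] by simp
  next
    case False
    then have "N \<le> n" by simp
    then show ?thesis using N
    proof (induction rule: inc_induct)
      case base
      then show ?case using up[of 0] by simp
    next
      case (step N)
      then have "fst ?x \<le> N" "fst ?y \<le> N" "max (fst ?x) (fst ?y) \<le> Suc N" by auto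
      then show ?case
        using L_fin_same_last(2)[OF step.IH[unfolded pi_fin_Suc[OF \<open>fst ?x \<le> N\<close>] pi_fin_Suc[OF \<open>fst ?y \<le> N\<close>]]]
          pi_fin_nonempty by blast
    qed
  qed
  then show ?thesis using tail_point_in_X\<^sub>0[OF X(1) r] tail_point_in_X\<^sub>0[OF X(2) r]
    by (auto simp: L\<^sub>0_def L_lim_def X\<^sub>0_def)
qed

text \<open>Pure parity, for any 2-colouring. The two copies of \<open>s_seq c\<^sub>0 n\<close> are
  joined by an odd path and get different colours. Vertices whose colour is tied to that of the
  all-zero vertex by a constant independent of the tail inherit this change, and induction shows
  that all vertices \<open>0 # t\<close> are such.\<close>

lemma L\<^sub>0_colouring_flip:
  assumes f: "\<And>x y. (x, y) \<in> L\<^sub>0 \<Longrightarrow> f x \<noteq> (f y :: bool)"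
    and t: "length t = n" "set t \<subseteq> {0, 1}" and r: "range r \<subseteq> {0, 1 :: nat}"
  shows "f (tail_point (Suc n) (0 # t @ [0]) r) \<noteq> f (tail_point (Suc n) (0 # t @ [1]) r)"
proof -
  define col where "col n v r = f (tail_point n v r)" for n v r
  define R where "R = {r :: nat \<Rightarrow> nat. range r \<subseteq> {0, 1}}"
  have edge: "col n v r \<noteq> col n w r" if "{v, w} \<in> L_fin c\<^sub>0 n" "r \<in> R" for n v w r
    unfolding col_def by (intro f tail_point_edge[OF that(1)]) (use that(2) in \<open>simp only: R_def mem_Collect_eq\<close>)
  have snoc: "col (Suc n) (v @ [j]) r = col n v (case_nat j r)" if "v \<noteq> []" for n v j r
    using that by (simp add: col_def tail_point_snoc)
  \<comment> \<open>The joining path has \<open>c\<^sub>0 (Suc n) + 2\<close> edges, an odd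
    number.\<close>
  have s_flip: "col n (s_seq c\<^sub>0 n) (case_nat 0 r) \<noteq> col n (s_seq c\<^sub>0 n) (case_nat 1 r)" if r: "r \<in> R" for n r
  proof -
    have path: "col (Suc n) [i] r = (col (Suc n) [0] r \<noteq> odd i)" if "i \<le> c\<^sub>0 (Suc n)" for i
      using that
    proof (induction i)
      case (Suc i)
      have "{[i], [Suc i]} \<in> path_edges (c\<^sub>0 (Suc n))" using Suc.prems unfolding path_edges_def by force
      then have "col (Suc n) [i] r \<noteq> col (Suc n) [Suc i] r" using edge[OF _ r, of "[i]" "[Suc i]" "Suc n"] by simp
      then show ?case using Suc by auto
    qed simp
    have "col (Suc n) [c\<^sub>0 (Suc n)] r \<noteq> col (Suc n) [0] r"
      using path[of "c\<^sub>0 (Suc n)"] by (simp add: c\<^sub>0_def)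
    moreover have "col (Suc n) (s_seq c\<^sub>0 n @ [0]) r \<noteq> col (Suc n) [0] r"
      "col (Suc n) [c\<^sub>0 (Suc n)] r \<noteq> col (Suc n) (s_seq c\<^sub>0 n @ [1]) r" by (rule edge[OF _ r]; simp)+
    moreover have "s_seq c\<^sub>0 n \<noteq> []" by (simp add: s_seq_def)
    ultimately show ?thesis using snoc by auto
  qed
  define Z where "Z n r = col n (0 # replicate n 0) r" for n r
  define follows where "follows n v \<longleftrightarrow> (\<exists>d. \<forall>r\<in>R. col n v r = (d \<noteq> Z n r))" for n v
  have shift: "case_nat j r \<in> R" if "r \<in> R" "j \<le> 1" for j r
  proof -
    have "case_nat j r i \<in> {0, 1}" for i
    proof (cases i)
      case 0 then show ?thesis using that(2) by auto
    next
      case (Suc i')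
      have "r i' \<in> {0, 1}" using that(1) unfolding R_def by blast
      then show ?thesis by (simp add: Suc)
    qed
    then show ?thesis unfolding R_def by (intro CollectI image_subsetI)
  qed
  have Z_flip: "Z n (case_nat 0 r) \<noteq> Z n (case_nat 1 r)" if "follows n (s_seq c\<^sub>0 n)" "r \<in> R" for n r
    using that s_flip[OF that(2), of n] shift[OF that(2)] unfolding follows_def by auto
  have follows_snoc: "follows (Suc n) (v @ [j])"
    if v: "follows n v" "v \<noteq> []" and s: "follows n (s_seq c\<^sub>0 n)" and j: "j \<le> 1" for n v j
  proof -
    obtain d where d: "\<And>r. r \<in> R \<Longrightarrow> col n v r = (d \<noteq> Z n r)" using v(1) unfolding follows_def by blast
    have Z0: "Z (Suc n) r = Z n (case_nat 0 r)" for r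
      using snoc[of "0 # replicate n 0" n 0 r] by (simp add: Z_def replicate_append_same)
    have "col (Suc n) (v @ [j]) r = ((d \<noteq> (j = 1)) \<noteq> Z (Suc n) r)" if r: "r \<in> R" for r
      using d[OF shift[OF r j]] Z_flip[OF s r] j unfolding snoc[OF v(2)] Z0 by (cases j) auto
    then show ?thesis unfolding follows_def by blast
  qed
  \<comment> \<open>\<open>s_seq c\<^sub>0 0\<close> is \<open>[1]\<close> and not of the form
    \<open>0 # t\<close>, hence the separate conjunct; from stage 1 on it is covered by the second
    one.\<close>
  have all: "follows n (s_seq c\<^sub>0 n) \<and> (\<forall>t. length t = n \<longrightarrow> set t \<subseteq> {0, 1} \<longrightarrow> follows n (0 # t))" for n
  proof (induction n)
    case 0
    have "{[0], [1]} \<in> L_fin c\<^sub>0 0"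
      unfolding L_fin.simps path_edges_def c\<^sub>0_def by (intro CollectI exI[of _ 0] exI[of _ 1]) simp
    then have "col 0 [1] r = (True \<noteq> Z 0 r)" if "r \<in> R" for r
      using edge[OF _ that, of "[0]" "[1]" 0] by (simp add: Z_def)
    then have "follows 0 (s_seq c\<^sub>0 0)" unfolding follows_def by (auto simp: s_seq_def c\<^sub>0_def)
    moreover have "follows 0 [0]" unfolding follows_def by (intro exI[of _ False]) (simp add: Z_def)
    ultimately show ?case by simp
  next
    case (Suc n)
    have "follows (Suc n) (0 # t)" if t: "length t = Suc n" "set t \<subseteq> {0, 1}" for t
    proof -
      obtain t' j where tj: "t = t' @ [j]" using t(1) by (metis length_Suc_conv_rev)
      then have "follows (Suc n) ((0 # t') @ [j])"
        by (intro follows_snoc) (use t Suc tj in auto)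
      then show ?thesis by (simp add: tj)
    qed
    moreover have "s_seq c\<^sub>0 (Suc n) = 0 # replicate n 0 @ [1]" by (simp add: s_seq_def)
    moreover have "set (replicate n 0 @ [1]) \<subseteq> {0, 1 :: nat}" by (cases n) auto
    ultimately show ?case by simp
  qed
  obtain d where d: "\<And>r. r \<in> R \<Longrightarrow> col n (0 # t) r = (d \<noteq> Z n r)"
  proof -
    have "follows n (0 # t)" using all[of n] t by simp
    then show thesis unfolding follows_def using that by (elim exE) simp
  qed
  have rR: "r \<in> R" unfolding R_def mem_Collect_eq by (rule r)
  have "Z n (case_nat 0 r) \<noteq> Z n (case_nat 1 r)" by (rule Z_flip[OF conjunct1[OF all] rR])
  then have "col (Suc n) ((0 # t) @ [0]) r \<noteq> col (Suc n) ((0 # t) @ [1]) r"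
    unfolding snoc[OF list.distinct(2)] d[OF shift[OF rR le0]] d[OF shift[OF rR order_refl]] by simp
  then show ?thesis by (simp add: col_def)
qed

lemma L\<^sub>0_not_borel_bipartite:
  assumes \<phi>: "continuous_on X\<^sub>0 \<phi>" "graph_hom X\<^sub>0 L\<^sub>0 UNIV G \<phi>"
  shows "\<not> borel_bipartite G"
proof
  assume "borel_bipartite G"
  then obtain C where C: "C \<in> sets borel" "\<And>x y. (x, y) \<in> G \<Longrightarrow> (x \<in> C) \<noteq> (y \<in> C)"
    unfolding borel_bipartite_def by auto
  have col: "(\<phi> x \<in> C) \<noteq> (\<phi> y \<in> C)" if "(x, y) \<in> L\<^sub>0" for x y
    using that C(2) \<phi>(2) unfolding graph_hom_def by blast
  define p where "p x = (0 :: nat, 0 :: nat, \<lambda>i. of_bool (x i) :: nat)" for x :: "nat \<Rightarrow> bool"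
  have pX: "p x \<in> X\<^sub>0" for x by (auto simp: p_def X\<^sub>0_def X_lim_def)
  have ob: "continuous_on UNIV (of_bool :: bool \<Rightarrow> nat)"
    by (auto simp: continuous_on_open_vimage intro: discrete_topology_class.open_discrete)
  have "continuous_on UNIV (\<lambda>x :: nat \<Rightarrow> bool. \<lambda>i. of_bool (x i) :: nat)"
    by (rule continuous_on_coordinatewise_then_product)
      (rule continuous_on_compose2[OF ob continuous_on_coord], simp)
  then have "continuous_on UNIV p" unfolding p_def by (intro continuous_on_Pair continuous_on_const)
  then have "continuous_on UNIV (\<lambda>x. \<phi> (p x))"
    by (rule continuous_on_compose2[OF \<phi>(1)]) (use pX in auto)
  then have "(\<lambda>x. \<phi> (p x)) \<in> borel_measurable borel" by (rule borel_measurable_continuous_onI)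
  then have "(\<lambda>x. \<phi> (p x)) -` C \<in> sets borel" using C(1) by (rule measurable_sets_borel)
  moreover have "sets (borel :: bool measure) = sets coin"
    by (auto intro: borel_open discrete_topology_class.open_discrete)
  then have "sets (PiM UNIV (\<lambda>_::nat. borel :: bool measure)) = sets (PiM UNIV (\<lambda>_::nat. coin))"
    by (intro sets_PiM_cong refl)
  ultimately have "(\<lambda>x. \<phi> (p x)) -` C \<in> sets (PiM UNIV (\<lambda>_::nat. coin))"
    by (simp add: sets_PiM_equal_borel)
  then show False
  proof (rule no_measurable_flip_alternating)
    fix n x
    define t where "t = map (\<lambda>i. of_bool (x i) :: nat) [0..<n]"
    define r where "r i = (of_bool (x (Suc n + i)) :: nat)" for i
    \<comment> \<open>\<open>t\<close> holds the bits before position \<open>n\<close> and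
      \<open>r\<close> those after it, so the last list entry is bit \<open>n\<close>.\<close>
    have p: "tail_point (Suc n) (0 # t @ [of_bool b]) r = p (x(n := b))" for b
      by (auto simp: tail_point_def p_def t_def r_def fun_eq_iff nth_append less_Suc_eq)
    have "(\<phi> (tail_point (Suc n) (0 # t @ [0]) r) \<in> C) \<noteq> (\<phi> (tail_point (Suc n) (0 # t @ [1]) r) \<in> C)"
      by (rule L\<^sub>0_colouring_flip[where f = "\<lambda>x. \<phi> x \<in> C"]) (use col in \<open>auto simp: t_def r_def\<close>)
    then have "(\<phi> (p (x(n := False))) \<in> C) \<noteq> (\<phi> (p (x(n := True))) \<in> C)"
      using p[of False] p[of True] by simp
    moreover have "x(n := x n) = x" by simp
    ultimately show "flip n x \<in> (\<lambda>x. \<phi> (p x)) -` C \<longleftrightarrow> x \<notin> (\<lambda>x. \<phi> (p x)) -` C"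
      by (cases "x n") auto
  qed
qed

section \<open>Borel chromatic number at most two\<close>

lemma standard_borel_count_space:
  assumes "countable A"
  shows "standard_borel (count_space A)"
  unfolding standard_borel_def
proof (intro exI conjI)
  show "topspace (discrete_topology A) = space (count_space A)" by simp
  show "completely_metrizable_space (discrete_topology A)"
    by (rule completely_metrizable_space_discrete_topology)
  show "second_countable (discrete_topology A)" using assms by (simp add: second_countable_discrete_topology)
  have "sigma_sets A (Pow A) = Pow A"
    by (rule sigma_algebra.sigma_sets_eq[OF sigma_algebra_Pow])
  moreover have "{U. openin (discrete_topology A) U} = Pow A" by auto
  ultimately show "sets (count_space A) = sigma_sets (space (count_space A)) {U. openin (discrete_topology A) U}"
    by simp
qed

lemma singleton_in_sets_standard_borel:
  assumes "standard_borel M" "a \<in> space M"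
  shows "{a} \<in> sets M"
proof -
  obtain T where T: "topspace T = space M" "completely_metrizable_space T"
    "sets M = sigma_sets (space M) {U. openin T U}"
    using assms(1) unfolding standard_borel_def by blast
  have "t1_space T"
    using T(2) completely_metrizable_imp_metrizable_space metrizable_imp_t1_space by blast
  then have "closedin T {a}" using assms(2) T(1) by (simp add: t1_space_closedin_finite)
  then have "openin T (topspace T - {a})" by (rule openin_diff[OF openin_topspace])
  then have "space M - {a} \<in> sets M" unfolding T(3) by (intro sigma_sets.Basic) (simp add: T(1))
  then have "space M - (space M - {a}) \<in> sets M" by (rule sets.compl_sets)
  moreover have "space M - (space M - {a}) = {a}" using assms(2) by auto
  ultimately show ?thesis by simp
qed

text \<open>The chromatic number has to exist as an attained minimum. Any colouring of a nonempty
  graph uses at least two colours, so the cardinal of \<open>{0, 1}\<close> is that minimum.\<close>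

lemma borel_bipartite_imp_chromatic_number_le_2:
  fixes G :: "('a::topological_space \<times> 'a) set"
  assumes "G \<noteq> {}" and "borel_bipartite G"
  shows "borel_chromatic_number_le G 2"
proof -
  obtain x0 y0 where xy0: "(x0, y0) \<in> G" using assms(1) by auto
  obtain C where C: "C \<in> sets borel" "\<And>x y. (x, y) \<in> G \<Longrightarrow> (x \<in> C) \<noteq> (y \<in> C)"
    using assms(2) unfolding borel_bipartite_def by auto
  let ?K = "card_of {0, 1 :: real}"
  have "borel_colourable G ?K" unfolding borel_colourable_def
  proof (intro exI conjI allI impI)
    show "space (count_space {0, 1 :: real}) = Field ?K" by (simp add: Field_card_of)
    show "standard_borel (count_space {0, 1 :: real})" by (rule standard_borel_count_space) simp
    show "(\<lambda>x. if x \<in> C then 1 else 0 :: real) \<in> measurable borel (count_space {0, 1 :: real})"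
    proof (rule measurableI)
      fix A :: "real set"
      have "(\<lambda>x. if x \<in> C then 1 else 0 :: real) -` A \<inter> space borel =
          (if 1 \<in> A then C else {}) \<union> (if 0 \<in> A then - C else {})" by auto
      moreover have "- C \<in> sets borel" using C(1) by (rule borel_comp)
      ultimately show "(\<lambda>x. if x \<in> C then 1 else 0 :: real) -` A \<inter> space borel \<in> sets borel"
        using C(1) by auto
    qed auto
    show "(if x \<in> C then 1 else 0 :: real) \<noteq> (if y \<in> C then 1 else 0)" if "(x, y) \<in> G" for x y
      using C(2)[OF that] by auto
  qed
  moreover have "(?K, \<mu>) \<in> ordLeq" if \<mu>: "Card_order \<mu>" "borel_colourable G \<mu>" for \<mu> :: "real rel"
  proof -
    obtain M and f :: "'a \<Rightarrow> real" where f: "space M = Field \<mu>" "f \<in> measurable borel M"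
      "\<And>x y. (x, y) \<in> G \<Longrightarrow> f x \<noteq> f y" using \<mu>(2) unfolding borel_colourable_def by blast
    have F: "f x0 \<in> Field \<mu>" "f y0 \<in> Field \<mu>" using measurable_space[OF f(2)] f(1) by auto
    have "inj_on (\<lambda>t. if t = 0 then f x0 else f y0) {0, 1 :: real}"
      using f(3)[OF xy0] by (auto simp: inj_on_def)
    moreover have "(\<lambda>t. if t = 0 then f x0 else f y0) ` {0, 1 :: real} \<subseteq> Field \<mu>" using F by auto
    ultimately have "(?K, card_of (Field \<mu>)) \<in> ordLeq" using card_of_ordLeq by blast
    then show ?thesis using card_of_Field_ordIso[OF \<mu>(1)] ordLeq_ordIso_trans by blast
  qed
  ultimately have "is_borel_chromatic_number G ?K"
    unfolding is_borel_chromatic_number_def by (simp add: card_of_Card_order)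
  moreover have "(?K, card_of {..<2 :: nat}) \<in> ordLeq"
  proof -
    have "inj_on (\<lambda>t :: real. if t = 0 then 0 else 1 :: nat) {0, 1}"
      "(\<lambda>t :: real. if t = 0 then 0 else 1 :: nat) ` {0, 1} \<subseteq> {..<2}" by (auto simp: inj_on_def)
    then show ?thesis using card_of_ordLeq by blast
  qed
  ultimately show "borel_chromatic_number_le G 2" unfolding borel_chromatic_number_le_def by blast
qed

text \<open>With at most two colours available, one of them decides everything. Its preimage is
  Borel because singletons are measurable in a standard Borel space.\<close>

lemma chromatic_number_le_2_imp_borel_bipartite:
  fixes G :: "('a::topological_space \<times> 'a) set"
  assumes "G \<noteq> {}" and "borel_chromatic_number_le G 2"
  shows "borel_bipartite G"
proof -
  obtain x0 y0 where xy0: "(x0, y0) \<in> G" using assms(1) by auto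
  obtain \<kappa> :: "real rel" where \<kappa>: "Card_order \<kappa>" "borel_colourable G \<kappa>"
    "(\<kappa>, card_of {..<2 :: nat}) \<in> ordLeq"
    using assms(2) unfolding borel_chromatic_number_le_def is_borel_chromatic_number_def by blast
  obtain M and f :: "'a \<Rightarrow> real" where f: "space M = Field \<kappa>" "standard_borel M"
    "f \<in> measurable borel M" "\<And>x y. (x, y) \<in> G \<Longrightarrow> f x \<noteq> f y"
    using \<kappa>(2) unfolding borel_colourable_def by blast
  have "(card_of (Field \<kappa>), card_of {..<2 :: nat}) \<in> ordLeq"
    using ordIso_ordLeq_trans[OF card_of_Field_ordIso[OF \<kappa>(1)] \<kappa>(3)] .
  then obtain h :: "real \<Rightarrow> nat" where h: "inj_on h (Field \<kappa>)" "h ` Field \<kappa> \<subseteq> {..<2}"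
    unfolding card_of_ordLeq[symmetric] by (elim exE conjE)
  have F: "f x \<in> Field \<kappa>" for x using measurable_space[OF f(3)] f(1) by auto
  have two: "a = c \<or> b = c" if "a \<in> Field \<kappa>" "b \<in> Field \<kappa>" "c \<in> Field \<kappa>" "a \<noteq> b" for a b c
  proof -
    have "h a < 2" "h b < 2" "h c < 2" using that(1-3) h(2) by auto
    moreover have "h a \<noteq> h b" using that h(1) by (metis inj_onD)
    ultimately have "h a = h c \<or> h b = h c" by arith
    then show ?thesis using that h(1) by (metis inj_onD)
  qed
  have "{f x0} \<in> sets M" using singleton_in_sets_standard_borel[OF f(2)] F f(1) by simp
  then have "f -` {f x0} \<inter> space borel \<in> sets borel" by (rule measurable_sets[OF f(3)])
  then have "f -` {f x0} \<in> sets borel" by simp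
  moreover have "(x \<in> f -` {f x0}) \<noteq> (y \<in> f -` {f x0})" if "(x, y) \<in> G" for x y
    using f(4)[OF that] two[OF F F F[of x0], of x y] by auto
  ultimately show "borel_bipartite G" unfolding borel_bipartite_def by (intro bexI) auto
qed

theorem theorem4p4:
  fixes G :: "('a::t2_space \<times> 'a) set"
  assumes "graph_on UNIV G"
    and "analytic_set G"
  shows "(borel_chromatic_number_le G 2 \<or>
          (\<exists>\<phi>. continuous_on X\<^sub>0 \<phi> \<and> graph_hom X\<^sub>0 L\<^sub>0 UNIV G \<phi>))
       \<and> \<not> (borel_chromatic_number_le G 2 \<and>
            (\<exists>\<phi>. continuous_on X\<^sub>0 \<phi> \<and> graph_hom X\<^sub>0 L\<^sub>0 UNIV G \<phi>))"
proof -
  obtain \<theta> :: "(nat \<Rightarrow> nat) \<Rightarrow> 'a \<times> 'a" where \<theta>: "continuous_on UNIV \<theta>" "range \<theta> = G"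
    using assms(2) unfolding analytic_set_def by blast
  interpret coded_graph G \<theta>
    using assms(1) \<theta> by unfold_locales (simp_all add: graph_on_def)
  \<comment> \<open>A continuous image of the whole Baire space is nonempty, so \<open>G\<close> has
    an edge and needs two colours.\<close>
  have "G \<noteq> {}" using \<theta>(2) by auto
  then have "borel_chromatic_number_le G 2 \<longleftrightarrow> borel_bipartite G"
    using borel_bipartite_imp_chromatic_number_le_2 chromatic_number_le_2_imp_borel_bipartite by blast
  then show ?thesis using L\<^sub>0_homomorphism_exists L\<^sub>0_not_borel_bipartite by blast
qed

end
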